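(* Let $n,k\ge1$ be integers and let $\mu,\nu$ be two compositions with $|\mu|+|\nu|=n$. Then the map $\Gamma:\mathrm{SortRec}_k(\mu;\nu)\to\mathrm{PF}_{n,kn}(\mu;\nu)$, which sends $c$ to the parking function $D$ with $f_D(i)=(n-1)k-\tilde c(i)+1$ for all $i\in[n]$, is a bijection, and for every $c\in\mathrm{SortRec}_k(\mu;\nu)$ $$\mathrm{lev}(c)=\mathrm{area}(\Gamma(c))\qquad\text{and}\qquad \mathrm{del}(c)=\mathrm{pmaj}(\Gamma(c)).$$
   Context: Write $[m]=\{1,\dots,m\}$. Compositions may be empty. **Blocks.** For $\mu=(\mu_1,\dots,\mu_r)$, $\nu=(\nu_1,\dots,\nu_s)$ with $|\mu|+|\nu|=n$, let $I_j=\{\nu_1+\dots+\nu_{j-1}+1,\dots,\nu_1+\dots+\nu_j\}$ for $1\le j\le s$ and $K_i=\{n-(\mu_1+\dots+\mu_i)+1,\dots,n-(\mu_1+\dots+\mu_{i-1})\}$ for $1\le i\le r$. These partition $[n]$. **Parking functions.** A Dyck path in the $n\times kn$ grid is a lattice path from $(0,0)$ to $(kn,n)$ made of unit north and unit east steps that never goes below $y=x/k$. Rows are numbered from bottom to top starting at $1$. An $(n,kn)$-parking function is such a path whose $n$ north steps are labelled bijectively by $[n]$, so that labels on the same vertical line increase from bottom to top; $\mathrm{PF}_{n,kn}$ is the set of them. For $D\in\mathrm{PF}_{n,kn}$, $f_D(\lambda)=a+1$ if the north step labelled $\lambda$ lies on $x=a$; $D$ is determined by $f_D$. $\mathrm{wrow}(D)$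 is the word of labels read by rows from bottom to top. $\mathrm{PF}_{n,kn}(\mu;\nu)$ is the set of $D\in\mathrm{PF}_{n,kn}$ such that in $\mathrm{wrow}(D)$ the elements of each $K_i$ appear in increasing order and the elements of each $I_j$ appear in decreasing order (left to right). **Area and pmaj.** $\mathrm{area}(D)=\sum_{i=1}^n w_i(D)$, where $w_i(D)=k(i-1)-a$ if the north step in row $i$ lies on $x=a$ (the number of whole unit squares in row $i$ between path and diagonal). Define a word $\sigma_1\cdots\sigma_{kn}$: set $B_0'=\varnothing$, $\sigma_0=n+1$; for $m=1,\dots,kn$ let $B_m$ be the multiset $B_{m-1}'$ plus $k$ copies of each $\lambda$ with $f_D(\lambda)=m$, let $X_m$ be the multiset of $a\in B_m$ with $a<\sigma_{m-1}$, let $\sigma_m=\max X_m$ if $X_m\neq\varnothing$ and $\sigma_m=\max B_m$ otherwise, and let $B_m'$ be $B_m$ with one copy of $\sigma_m$ removed. $p_\lambda(D)$ is the number of $j\ge1$ with $\sigma_j\le\sigma_{j+1}$ and $j+1\le$ the position of the leftmost $\lambda$; $\mathrm{pmaj}(D)=\sum_{\lambda\in[n]} p_\lambda(D)$. **Graph.** $G=G^{(k)}_{\mu,\nu}$ is the loopless multigraph on $\{0,1,\dots,n\}$ with edge multiplicities $\epsilon$: $\epsilon(0,v)=1$ for $v\in[n]$; $\epsilon(v,w)=k-1$ for distinct $v,w$ in the same block $I_j$; $\epsilon(v,w)=k$ for all other pairs of distinct $v,w\in[n]$. Vertex $0$ is the sink. $\deg_G(v)$ counts edges with multiplicity. **Configurations.**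 A configuration is a map $c:[n]\to\mathbb Z$ (the value at the sink is ignored). It is non-negative if all $c(v)\ge0$, stable if all $c(v)<\deg_G(v)$; $v\in[n]$ is unstable in $c$ if $c(v)\ge\deg_G(v)$. Toppling a vertex $v$ gives $\phi_v(c)$: value at $v$ decreases by $\deg_G(v)$, value at each $w\ne v$ increases by $\epsilon(v,w)$ ($v=0$ allowed). $c$ is recurrent if it is non-negative, stable and there is an ordering $\tau_1,\dots,\tau_n$ of $[n]$ such that $\phi_0(c),\phi_{\tau_1}\phi_0(c),\dots,\phi_{\tau_n}\cdots\phi_{\tau_1}\phi_0(c)$ are all non-negative. $\mathrm{SortRec}_k(\mu;\nu)$ is the set of recurrent configurations $c$ of $G$ that are sorted: $i\mapsto c(i)$ is weakly increasing on each block $I_j$ and weakly decreasing on each block $K_i$. **Level.** $\mathrm{lev}(c)=-|E_0|+\sum_{i=1}^nc(i)$, where $|E_0|$ is the number (with multiplicity) of edges of $G$ not incident to $0$. **Delay.** A grain release on $v$ with threshold $m$ gives $\psi^{(m)}_v(c)$: value at $v$ decreases by $\#\{w\ne v:\epsilon(v,w)\ge m\}$ ($w$ ranges over all vertices including $0$), and value at each $w\neq v$ with $\epsilon(v,w)\ge m$ increases by $1$. Algorithm on a recurrent $c$: replace $c$ by $\phi_0(c)$; set $r=(r_1,\dots,r_n)=(0,\dots,0)$, $d=0$, $n_{\rm cyc}=0$. While $r\ne(k,\dots,k)$: for $i=n,n-1,\dots,1$ do: [if $r_i=0$ and $i$ is unstable, increase $d$ by $n_{\rm cyc}$, replace $c$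 by $\psi_i^{(k)}(c)$ and set $r_i=1$; else if $0<r_i<k$, replace $c$ by $\psi_i^{(k-r_i)}(c)$ and increase $r_i$ by $1$]; then increase $n_{\rm cyc}$ by $1$. $\mathrm{del}(c)$ is the final value of $d$. **Embedding.** For $c\in\mathrm{SortRec}_k(\mu;\nu)$, $\tilde c:[n]\to\mathbb Z$ is given by $\tilde c(v)=c(v)$ if $v$ is in some $K_i$, and $\tilde c(v)=c(v)+(r-1)$ if $v$ is the $r$-th smallest element of some $I_j$. *)

theory Defs
  imports "HOL-Library.FuncSet" "HOL-Library.Multiset" "HOL-Library.While_Combinator"
begin

definition composition :: "nat list \<Rightarrow> bool" where
  "composition xs \<longleftrightarrow> (\<forall>x\<in>set xs. 0 < x)"

text \<open>List entries are indexed from 0, so the \<open>j\<close>-th block of the text is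
  \<open>I_block \<nu> (j - 1)\<close>, and similarly for \<open>K_block\<close>.\<close>

definition I_block :: "nat list \<Rightarrow> nat \<Rightarrow> nat set" where
  "I_block \<nu> j = {sum_list (take j \<nu>) + 1 .. sum_list (take (Suc j) \<nu>)}"

definition K_block :: "nat \<Rightarrow> nat list \<Rightarrow> nat \<Rightarrow> nat set" where
  "K_block n \<mu> i = {n - sum_list (take (Suc i) \<mu>) + 1 .. n - sum_list (take i \<mu>)}"


section \<open>Parking functions\<close>

text \<open>A labelled lattice path starting at the origin is the list of its unit steps;
  every north step carries its label.\<close>

datatype pf_step = North nat | East

type_synonym labelled_path = "pf_step list"

definition easts :: "labelled_path \<Rightarrow> nat" where
  "easts p = length (filter (\<lambda>s. s = East) p)"

definition norths :: "labelled_path \<Rightarrow> nat" where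
  "norths p = length (filter (\<lambda>s. s \<noteq> East) p)"

fun step_labels :: "pf_step \<Rightarrow> nat list" where
  "step_labels (North l) = [l]"
| "step_labels East = []"

definition wrow :: "labelled_path \<Rightarrow> nat list" where
  "wrow D = concat (map step_labels D)"

text \<open>The point reached after \<open>m\<close> steps is \<open>(easts (take m p), norths (take m p))\<close>.\<close>

definition dyck_path :: "nat \<Rightarrow> nat \<Rightarrow> labelled_path \<Rightarrow> bool" where
  "dyck_path n k p \<longleftrightarrow> norths p = n \<and> easts p = k * n \<and>
     (\<forall>m\<le>length p. easts (take m p) \<le> k * norths (take m p))"

definition PF :: "nat \<Rightarrow> nat \<Rightarrow> labelled_path set" where
  "PF n k = {D. dyck_path n k D \<and> distinct (wrow D) \<and> set (wrow D) = {1..n} \<and>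
     (\<forall>i j a b. i < j \<and> j < length D \<and> D ! i = North a \<and> D ! j = North b \<and>
        easts (take i D) = easts (take j D) \<longrightarrow> a < b)}"

text \<open>\<open>xpos D l\<close> is the abscissa of the (unique) north step labelled \<open>l\<close>.\<close>

definition xpos :: "labelled_path \<Rightarrow> nat \<Rightarrow> nat" where
  "xpos D l = easts (takeWhile (\<lambda>s. s \<noteq> North l) D)"

definition f_pf :: "labelled_path \<Rightarrow> nat \<Rightarrow> nat" where
  "f_pf D l = xpos D l + 1"

definition PF_shuffle :: "nat \<Rightarrow> nat \<Rightarrow> nat list \<Rightarrow> nat list \<Rightarrow> labelled_path set" where
  "PF_shuffle n k \<mu> \<nu> = {D \<in> PF n k.
     (\<forall>i<length \<mu>. sorted_wrt (<) (filter (\<lambda>l. l \<in> K_block n \<mu> i) (wrow D))) \<and>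
     (\<forall>j<length \<nu>. sorted_wrt (>) (filter (\<lambda>l. l \<in> I_block \<nu> j) (wrow D)))}"

text \<open>The north step in row \<open>i\<close> is the one labelled by the \<open>i\<close>-th letter of \<open>wrow D\<close>.\<close>

definition area :: "nat \<Rightarrow> nat \<Rightarrow> labelled_path \<Rightarrow> int" where
  "area n k D = (\<Sum>i=1..n. int k * (int i - 1) - int (xpos D (wrow D ! (i - 1))))"

text \<open>\<open>pmaj_state n k D m\<close> is the pair \<open>(B'\<^sub>m, \<sigma>\<^sub>m)\<close>.\<close>

primrec pmaj_state :: "nat \<Rightarrow> nat \<Rightarrow> labelled_path \<Rightarrow> nat \<Rightarrow> nat multiset \<times> nat" where
  "pmaj_state n k D 0 = ({#}, n + 1)"
| "pmaj_state n k D (Suc m) =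
    (let B = fst (pmaj_state n k D m) +
               (\<Sum>l\<in>{l\<in>{1..n}. f_pf D l = Suc m}. replicate_mset k l);
         X = filter_mset (\<lambda>a. a < snd (pmaj_state n k D m)) B;
         s = (if X \<noteq> {#} then Max (set_mset X) else Max (set_mset B))
     in (B - {#s#}, s))"

definition sigma :: "nat \<Rightarrow> nat \<Rightarrow> labelled_path \<Rightarrow> nat \<Rightarrow> nat" where
  "sigma n k D m = snd (pmaj_state n k D m)"

definition first_pos :: "nat \<Rightarrow> nat \<Rightarrow> labelled_path \<Rightarrow> nat \<Rightarrow> nat" where
  "first_pos n k D l = (LEAST m. m \<in> {1..k * n} \<and> sigma n k D m = l)"

definition p_stat :: "nat \<Rightarrow> nat \<Rightarrow> labelled_path \<Rightarrow> nat \<Rightarrow> nat" where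
  "p_stat n k D l =
     card {j. 1 \<le> j \<and> sigma n k D j \<le> sigma n k D (j + 1) \<and> j + 1 \<le> first_pos n k D l}"

definition pmaj :: "nat \<Rightarrow> nat \<Rightarrow> labelled_path \<Rightarrow> nat" where
  "pmaj n k D = (\<Sum>l=1..n. p_stat n k D l)"


section \<open>Sandpile configurations\<close>

text \<open>A loopless multigraph on the vertices \<open>{0..n}\<close> with sink \<open>0\<close> is given by \<open>n\<close> and its
  edge multiplicities. A configuration is extensional, i.e. \<open>undefined\<close> outside \<open>{1..n}\<close>, so
  that equality of configurations is equality on \<open>{1..n}\<close>.\<close>

type_synonym multiplicities = "nat \<Rightarrow> nat \<Rightarrow> nat"
type_synonym config = "nat \<Rightarrow> int"

definition configs :: "nat \<Rightarrow> config set" where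
  "configs n = {1..n} \<rightarrow>\<^sub>E UNIV"

definition deg :: "nat \<Rightarrow> multiplicities \<Rightarrow> nat \<Rightarrow> nat" where
  "deg n \<epsilon> v = (\<Sum>w\<in>{0..n} - {v}. \<epsilon> v w)"

definition nonneg :: "nat \<Rightarrow> config \<Rightarrow> bool" where
  "nonneg n c \<longleftrightarrow> (\<forall>v\<in>{1..n}. 0 \<le> c v)"

definition unstable :: "nat \<Rightarrow> multiplicities \<Rightarrow> config \<Rightarrow> nat \<Rightarrow> bool" where
  "unstable n \<epsilon> c v \<longleftrightarrow> int (deg n \<epsilon> v) \<le> c v"

definition stable :: "nat \<Rightarrow> multiplicities \<Rightarrow> config \<Rightarrow> bool" where
  "stable n \<epsilon> c \<longleftrightarrow> (\<forall>v\<in>{1..n}. c v < int (deg n \<epsilon> v))"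

definition topple :: "nat \<Rightarrow> multiplicities \<Rightarrow> nat \<Rightarrow> config \<Rightarrow> config" where
  "topple n \<epsilon> v c =
     (\<lambda>w\<in>{1..n}. if w = v then c w - int (deg n \<epsilon> v) else c w + int (\<epsilon> v w))"

definition recurrent :: "nat \<Rightarrow> multiplicities \<Rightarrow> config \<Rightarrow> bool" where
  "recurrent n \<epsilon> c \<longleftrightarrow> nonneg n c \<and> stable n \<epsilon> c \<and>
     (\<exists>\<tau>. distinct \<tau> \<and> set \<tau> = {1..n} \<and>
        (\<forall>m\<le>n. nonneg n (fold (topple n \<epsilon>) (take m \<tau>) (topple n \<epsilon> 0 c))))"

text \<open>The graph \<open>G\<close> depends on \<open>\<mu>\<close> only through \<open>n = |\<mu>| + |\<nu>|\<close>.\<close>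

definition G_mult :: "nat \<Rightarrow> nat \<Rightarrow> nat list \<Rightarrow> multiplicities" where
  "G_mult n k \<nu> v w =
     (if v = w \<or> v \<notin> {0..n} \<or> w \<notin> {0..n} then 0
      else if v = 0 \<or> w = 0 then 1
      else if \<exists>j<length \<nu>. v \<in> I_block \<nu> j \<and> w \<in> I_block \<nu> j then k - 1
      else k)"

definition sorted_config :: "nat \<Rightarrow> nat list \<Rightarrow> nat list \<Rightarrow> config \<Rightarrow> bool" where
  "sorted_config n \<mu> \<nu> c \<longleftrightarrow>
     (\<forall>j<length \<nu>. monotone_on (I_block \<nu> j) (\<le>) (\<le>) c) \<and>
     (\<forall>i<length \<mu>. monotone_on (K_block n \<mu> i) (\<le>) (\<ge>) c)"

definition SortRec :: "nat \<Rightarrow> nat \<Rightarrow> nat list \<Rightarrow> nat list \<Rightarrow> config set" where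
  "SortRec n k \<mu> \<nu> =
     {c \<in> configs n. recurrent n (G_mult n k \<nu>) c \<and> sorted_config n \<mu> \<nu> c}"

definition lev :: "nat \<Rightarrow> multiplicities \<Rightarrow> config \<Rightarrow> int" where
  "lev n \<epsilon> c = - int (\<Sum>v=1..n. \<Sum>w=v+1..n. \<epsilon> v w) + (\<Sum>i=1..n. c i)"


section \<open>Delay\<close>

definition grain_release :: "nat \<Rightarrow> multiplicities \<Rightarrow> nat \<Rightarrow> nat \<Rightarrow> config \<Rightarrow> config" where
  "grain_release n \<epsilon> m v c =
     (\<lambda>w\<in>{1..n}. if w = v then c w - int (card {u \<in> {0..n} - {v}. m \<le> \<epsilon> v u})
                  else if m \<le> \<epsilon> v w then c w + 1 else c w)"

text \<open>States of the algorithm are tuples \<open>(c, r, d, n\<^sub>c\<^sub>y\<^sub>c)\<close>.\<close>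

type_synonym delay_state = "config \<times> (nat \<Rightarrow> nat) \<times> nat \<times> nat"

definition delay_visit :: "nat \<Rightarrow> nat \<Rightarrow> multiplicities \<Rightarrow> nat \<Rightarrow> delay_state \<Rightarrow> delay_state" where
  "delay_visit n k \<epsilon> i = (\<lambda>(c, r, d, ncyc).
     if r i = 0 \<and> unstable n \<epsilon> c i
       then (grain_release n \<epsilon> k i c, r(i := 1), d + ncyc, ncyc)
     else if 0 < r i \<and> r i < k
       then (grain_release n \<epsilon> (k - r i) i c, r(i := r i + 1), d, ncyc)
     else (c, r, d, ncyc))"

definition delay_cycle :: "nat \<Rightarrow> nat \<Rightarrow> multiplicities \<Rightarrow> delay_state \<Rightarrow> delay_state" where
  "delay_cycle n k \<epsilon> s =
     (case fold (delay_visit n k \<epsilon>) (rev [1..<Suc n]) s of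
        (c, r, d, ncyc) \<Rightarrow> (c, r, d, ncyc + 1))"

text \<open>\<open>del\<close> is \<open>None\<close> if the loop does not terminate, and otherwise \<open>Some\<close> of the final \<open>d\<close>.\<close>

definition del :: "nat \<Rightarrow> nat \<Rightarrow> multiplicities \<Rightarrow> config \<Rightarrow> nat option" where
  "del n k \<epsilon> c =
     map_option (\<lambda>(c, r, d, ncyc). d)
       (while_option (\<lambda>(c, r, d, ncyc). \<exists>i\<in>{1..n}. r i \<noteq> k) (delay_cycle n k \<epsilon>)
          (topple n \<epsilon> 0 c, \<lambda>_. 0, 0, 0))"


section \<open>The map from configurations to parking functions\<close>

text \<open>If \<open>v\<close> is the \<open>r\<close>-th smallest element of its block, then \<open>r - 1\<close> elements of the block
  are smaller than \<open>v\<close>.\<close>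

definition embed :: "nat \<Rightarrow> nat list \<Rightarrow> nat list \<Rightarrow> config \<Rightarrow> config" where
  "embed n \<mu> \<nu> c = (\<lambda>v\<in>{1..n}.
     if \<exists>i<length \<mu>. v \<in> K_block n \<mu> i then c v
     else c v + int (card {u. u < v \<and> (\<exists>j<length \<nu>. u \<in> I_block \<nu> j \<and> v \<in> I_block \<nu> j)}))"

definition Gamma_rel ::
  "nat \<Rightarrow> nat \<Rightarrow> nat list \<Rightarrow> nat list \<Rightarrow> config \<Rightarrow> labelled_path \<Rightarrow> bool" where
  "Gamma_rel n k \<mu> \<nu> c D \<longleftrightarrow> D \<in> PF n k \<and>
     (\<forall>i\<in>{1..n}. int (f_pf D i) = (int n - 1) * int k - embed n \<mu> \<nu> c i + 1)"

definition Gamma :: "nat \<Rightarrow> nat \<Rightarrow> nat list \<Rightarrow> nat list \<Rightarrow> config \<Rightarrow> labelled_path" where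
  "Gamma n k \<mu> \<nu> c = (THE D. Gamma_rel n k \<mu> \<nu> c D)"

end

theory Submission
  imports Defs "HOL-Library.Product_Lexorder"
begin

text \<open>
  Everything is expressed through one function on the vertices, the column
  \<open>f v = (n - 1) k - c v - b v + 1\<close>, where \<open>b v\<close> is the number of elements of the block
  \<open>I\<^sub>j\<close> of \<open>v\<close> below \<open>v\<close>. A parking function \<open>D\<close> is determined by \<open>f\<^sub>D\<close>
  (\<open>PF_eqI\<close>), and a function \<open>f\<close> with positive values is some \<open>f\<^sub>D\<close> exactly if
  \<open>k * #{v. f v \<le> m} \<ge> m\<close> for \<open>1 \<le> m \<le> k n\<close> (\<open>parking_f_pf\<close>, \<open>PF_exists\<close>). Hence
  \<open>\<Gamma>\<close> amounts to a comparison of conditions on \<open>c\<close> with conditions on \<open>f\<close>.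

  \<^bold>\<open>Sortedness.\<close> On a block \<open>I\<^sub>j\<close>, adding \<open>b v\<close> turns a weakly increasing \<open>c\<close> into a
  strictly decreasing \<open>f\<close>. The row word lists the labels by column and increasingly within a
  column, so the labels of \<open>I\<^sub>j\<close> appear in decreasing order exactly if \<open>f\<close> decreases strictly on
  \<open>I\<^sub>j\<close>, and those of \<open>K\<^sub>i\<close> appear in increasing order exactly if \<open>f\<close> increases weakly on
  \<open>K\<^sub>i\<close> (\<open>block_increasing_iff\<close>, \<open>PF_shuffle_iff\<close>).

  \<^bold>\<open>Recurrence.\<close> Once the sink and the vertices of a set \<open>T\<close> have toppled, \<open>v \<notin> T\<close> is unstable if
  and only if \<open>f v - 1 \<le> k |T| + (elements of its block above v) - (elements of its block in T)\<close>
  (\<open>toppled_value\<close>). If \<open>T\<close> consists of the labels before \<open>v\<close> in the row word of \<open>D\<close>, the last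
  two numbers agree and what remains is the Dyck condition at the step labelled \<open>v\<close>; so the row
  word is a legal toppling order (\<open>parking_imp_recurrent\<close>). Conversely, if the counting condition
  fails at \<open>m\<close>, the first vertex with \<open>f v > m\<close> in any order is not yet unstable when its turn
  comes (\<open>recurrent_imp_parking\<close>).

  \<^bold>\<open>Level and area\<close> are both equal to \<open>\<Sum>\<^sub>v (c v + b v) - k n (n - 1) / 2\<close>.

  \<^bold>\<open>Delay and pmaj.\<close> Let \<open>t\<close> be the number of grain releases so far. A release by \<open>u\<close> sends a
  grain to \<open>v\<close> unless it is the first release of \<open>u\<close> and \<open>u\<close> lies in the block of \<open>v\<close>. So a
  vertex \<open>v\<close> without releases holds \<open>c v + 1 + t\<close> minus the number of elements of its block
  that have started to release. Within a block the larger elements start first, which makes \<open>v\<close>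
  unstable at its visit exactly if \<open>f v \<le> t + 1\<close> (\<open>unstable_iff\<close>). Therefore the vertices that
  can make the next release are the elements of the multiset \<open>B\<^bsub>t+1\<^esub>\<close> in the
  definition of pmaj, and \<open>v\<close> occurs there once for each of its remaining releases. The sweep
  \<open>n, \<dots>, 1\<close> selects the largest of them below the last vertex that released, and if there is
  none a new sweep selects the largest of all. This is the rule for \<open>\<sigma>\<^bsub>t+1\<^esub>\<close>: the
  word \<open>\<sigma>\<close> is the sequence of releases, new sweeps are its weak ascents, and the number of
  completed sweeps at the first release of \<open>v\<close> is \<open>p\<^sub>v\<close>.
\<close>

section \<open>Labelled paths\<close>

lemma path_cases [case_names Nil East North]:
  obtains "p = []" | q where "p = East # q" | l q where "p = North l # q"
  by (metis list.exhaust pf_step.exhaust)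

lemma path_induct [case_names Nil East North]:
  assumes "P []" "\<And>p. P p \<Longrightarrow> P (East # p)" "\<And>l p. P p \<Longrightarrow> P (North l # p)"
  shows "P p"
proof (induction p)
  case (Cons s p)
  then show ?case using assms by (cases s) auto
qed (rule assms)

text \<open>The abscissa and label of every north step, in the order of the path, for a path that starts at
abscissa \<open>a\<close>. With the lexicographic order on pairs, the condition that labels increase along
vertical lines says that this list is strictly increasing. A strictly increasing list is
determined by its set of entries, hence so is a parking function.\<close>

fun points :: "nat \<Rightarrow> labelled_path \<Rightarrow> (nat \<times> nat) list" where
  "points a [] = []"
| "points a (East # p) = points (Suc a) p"
| "points a (North l # p) = (a, l) # points a p"

lemma easts_simps [simp]:
  "easts [] = 0" "easts (East # p) = Suc (easts p)" "easts (North l # p) = easts p"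
  "easts (p @ q) = easts p + easts q" "easts (map North ls) = 0"
  by (induction ls) (simp_all add: easts_def)

lemma norths_simps [simp]:
  "norths [] = 0" "norths (East # p) = norths p" "norths (North l # p) = Suc (norths p)"
  "norths (p @ q) = norths p + norths q" "norths (map North ls) = length ls"
  by (induction ls) (simp_all add: norths_def)

lemma wrow_simps [simp]:
  "wrow [] = []" "wrow (East # p) = wrow p" "wrow (North l # p) = l # wrow p"
  "wrow (p @ q) = wrow p @ wrow q" "wrow (map North ls) = ls"
  by (induction ls) (simp_all add: wrow_def)

lemma points_append [simp]: "points a (p @ q) = points a p @ points (a + easts p) q"
  by (induction a p rule: points.induct) simp_all

lemma points_map_North [simp]: "points a (map North ls) = map (Pair a) ls"
  by (induction ls) simp_all

lemma map_snd_points [simp]: "map snd (points a p) = wrow p"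
  by (induction a p rule: points.induct) simp_all

lemma length_wrow [simp]: "length (wrow p) = norths p"
  by (induction p rule: path_induct) simp_all

lemma set_wrow: "set (wrow p) = snd ` set (points a p)"
  by (metis image_set map_snd_points)

lemma points_lower: "(x, l) \<in> set (points a p) \<Longrightarrow> a \<le> x"
  by (induction a p rule: points.induct) auto

lemma points_upper: "(x, l) \<in> set (points a p) \<Longrightarrow> x \<le> a + easts p"
  by (induction a p rule: points.induct) auto

lemma set_points_nth:
  "(x, l) \<in> set (points a p) \<longleftrightarrow> (\<exists>j<length p. p ! j = North l \<and> x = a + easts (take j p))"
  by (induction a p rule: points.induct) (auto simp: Ex_less_Suc2)

lemma xpos_points: "(x, l) \<in> set (points a p) \<Longrightarrow> distinct (wrow p) \<Longrightarrow> x = a + xpos p l"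
proof (induction a p rule: points.induct)
  case (3 a m p)
  have "l \<in> set (wrow p)" if "(x, l) \<in> set (points a p)"
    using that by (force simp: set_wrow[of _ a])
  with 3 show ?case by (auto simp: xpos_def)
qed (auto simp: xpos_def)

lemma points_inject: "points a p = points a q \<Longrightarrow> easts p = easts q \<Longrightarrow> p = q"
proof (induction a p arbitrary: q rule: points.induct)
  case (1 a)
  then show ?case by (cases q rule: path_cases) auto
next
  case (2 a p)
  show ?case
  proof (cases q rule: path_cases)
    case (North l q')
    with "2.prems" have "(a, l) \<in> set (points (Suc a) p)" by simp
    then show ?thesis using points_lower by fastforce
  qed (use 2 in auto)
next
  case (3 a l p)
  show ?case
  proof (cases q rule: path_cases)
    case (East q')
    with "3.prems" have "points (Suc a) q' = (a, l) # points a p" by simp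
    then have "(a, l) \<in> set (points (Suc a) q')" by simp
    then show ?thesis using points_lower by fastforce
  qed (use 3 in auto)
qed

text \<open>Along a path the abscissas of the north steps increase weakly, so the lexicographic order of two
entries can only fail at equal abscissas.\<close>

lemma columns_increasing_iff:
  "(\<forall>i j a b. i < j \<and> j < length p \<and> p ! i = North a \<and> p ! j = North b \<and>
      easts (take i p) = easts (take j p) \<longrightarrow> a < b) \<longleftrightarrow> sorted_wrt (<) (points x p)"
  (is "?cols p \<longleftrightarrow> _")
proof (induction x p rule: points.induct)
  case (2 x p)
  have "?cols (East # p) \<longleftrightarrow> ?cols p"
  proof (intro iffI allI impI)
    fix i j a b
    assume cols: "?cols (East # p)" and ij: "i < j \<and> j < length p \<and>
      p ! i = North a \<and> p ! j = North b \<and>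
      easts (take i p) = easts (take j p)"
    show "a < b" using cols[rule_format, of "Suc i" "Suc j" a b] ij by simp
  next
    fix i j a b
    assume cols: "?cols p" and ij: "i < j \<and> j < length (East # p) \<and>
      (East # p) ! i = North a \<and> (East # p) ! j = North b \<and>
      easts (take i (East # p)) = easts (take j (East # p))"
    obtain i' j' where "i = Suc i'" "j = Suc j'" using ij by (cases i; cases j) auto
    then show "a < b" using cols[rule_format, of i' j' a b] ij by simp
  qed
  with 2 show ?case by simp
next
  case (3 x l p)
  have "?cols (North l # p) \<longleftrightarrow>
      ?cols p \<and> (\<forall>j b. j < length p \<and> p ! j = North b \<and> easts (take j p) = 0 \<longrightarrow> l < b)"
  proof (intro iffI conjI allI impI)
    fix i j a b
    assume cols: "?cols (North l # p)" and ij: "i < j \<and> j < length p \<and>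
      p ! i = North a \<and> p ! j = North b \<and>
      easts (take i p) = easts (take j p)"
    show "a < b" using cols[rule_format, of "Suc i" "Suc j" a b] ij by simp
  next
    fix j b
    assume cols: "?cols (North l # p)" and ij: "j < length p \<and> p ! j = North b \<and> easts (take j p) = 0"
    show "l < b" using cols[rule_format, of 0 "Suc j" l b] ij by simp
  next
    fix i j a b
    assume cols: "?cols p \<and> (\<forall>j b. j < length p \<and> p ! j = North b \<and> easts (take j p) = 0 \<longrightarrow> l < b)"
      and ij: "i < j \<and> j < length (North l # p) \<and>
      (North l # p) ! i = North a \<and> (North l # p) ! j = North b \<and>
      easts (take i (North l # p)) = easts (take j (North l # p))"
    obtain j' where j: "j = Suc j'" using ij by (cases j) auto
    show "a < b"
    proof (cases i)
      case 0
      then show ?thesis using cols[THEN conjunct2, rule_format, of j' b] ij j by simp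
    next
      case (Suc i')
      then show ?thesis using cols[THEN conjunct1, rule_format, of i' j' a b] ij j by simp
    qed
  qed
  moreover have "(\<forall>j b. j < length p \<and> p ! j = North b \<and> easts (take j p) = 0 \<longrightarrow> l < b)
      \<longleftrightarrow> (\<forall>z\<in>set (points x p). (x, l) < z)"
  proof -
    have "(\<forall>z\<in>set (points x p). (x, l) < z) \<longleftrightarrow>
        (\<forall>y b. (\<exists>j<length p. p ! j = North b \<and> y = x + easts (take j p)) \<longrightarrow> (x, l) < (y, b))"
      by (simp only: Ball_def split_paired_All set_points_nth)
    also have "\<dots> \<longleftrightarrow> (\<forall>j b. j < length p \<and> p ! j = North b \<and> easts (take j p) = 0 \<longrightarrow> l < b)"
      by (force simp: less_prod_def)
    finally show ?thesis ..
  qed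
  ultimately show ?case using 3 by (simp only: points.simps sorted_wrt.simps) blast
qed simp

lemma PF_iff:
  "D \<in> PF n k \<longleftrightarrow> dyck_path n k D \<and> distinct (wrow D) \<and> set (wrow D) = {1..n} \<and>
     sorted_wrt (<) (points 0 D)"
  unfolding PF_def mem_Collect_eq columns_increasing_iff[of D 0] ..

lemma set_points_PF:
  assumes "D \<in> PF n k"
  shows "set (points 0 D) = (\<lambda>l. (xpos D l, l)) ` {1..n}"
proof -
  have dist: "distinct (wrow D)" and labels: "{1..n} = snd ` set (points 0 D)"
    using assms set_wrow[of D 0] by (auto simp: PF_iff)
  have "(xpos D (snd z), snd z) = z" if "z \<in> set (points 0 D)" for z
    using xpos_points[of "fst z" "snd z" 0 D] that dist by (cases z) auto
  then have "(\<lambda>z. (xpos D (snd z), snd z)) ` set (points 0 D) = set (points 0 D)"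
    by (simp add: image_def)
  then show ?thesis unfolding labels image_image by simp
qed

lemma PF_eqI:
  assumes D: "D \<in> PF n k" and E: "E \<in> PF n k"
    and eq: "\<And>l. l \<in> {1..n} \<Longrightarrow> f_pf D l = f_pf E l"
  shows "D = E"
proof -
  have "set (points 0 D) = set (points 0 E)"
    unfolding set_points_PF[OF D] set_points_PF[OF E] using eq by (auto simp: f_pf_def image_def)
  then have "points 0 D = points 0 E"
    using D E by (intro strict_sorted_equal) (auto simp: PF_iff)
  moreover have "easts D = easts E" using D E by (simp add: PF_iff dyck_path_def)
  ultimately show ?thesis by (rule points_inject)
qed

text \<open>The row word reads the labels by column, and within a column from the bottom, that is,
increasingly.\<close>

lemma PF_wrow_sorted:
  assumes "D \<in> PF n k"
  shows "sorted_wrt (\<lambda>u v. (f_pf D u, u) < (f_pf D v, v)) (wrow D)"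
proof -
  have dist: "distinct (wrow D)" and sorted: "sorted_wrt (<) (points 0 D)"
    using assms by (auto simp: PF_iff)
  have point: "(xpos D (snd z), snd z) = z" if "z \<in> set (points 0 D)" for z
    using xpos_points[of "fst z" "snd z" 0 D] that dist by (cases z) auto
  have "sorted_wrt (\<lambda>y z. (xpos D (snd y), snd y) < (xpos D (snd z), snd z)) (points 0 D)"
  proof (rule sorted_wrt_mono_rel[OF _ sorted])
    fix y z assume "y \<in> set (points 0 D)" "z \<in> set (points 0 D)" "y < z"
    then show "(xpos D (snd y), snd y) < (xpos D (snd z), snd z)"
      by (metis point)
  qed
  then have "sorted_wrt (\<lambda>u v. (xpos D u, u) < (xpos D v, v)) (map snd (points 0 D))"
    by (simp only: sorted_wrt_map)
  then show ?thesis by (simp add: f_pf_def less_prod_def)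
qed

section \<open>Columns of parking functions\<close>

lemma East_step_exists: "m < easts p \<Longrightarrow> \<exists>P Q. p = P @ East # Q \<and> easts P = m"
proof (induction p arbitrary: m rule: path_induct)
  case (East p)
  show ?case
  proof (cases m)
    case 0
    then show ?thesis by (intro exI[of _ "[]"] exI[of _ p]) simp
  next
    case (Suc m')
    then have "m' < easts p" using East.prems by simp
    then obtain P Q where "p = P @ East # Q" "easts P = m'" using East.IH by blast
    with Suc show ?thesis by (intro exI[of _ "East # P"] exI[of _ Q]) simp
  qed
next
  case (North l p)
  then have "m < easts p" by simp
  then obtain P Q where "p = P @ East # Q" "easts P = m" using North.IH by blast
  then show ?case by (intro exI[of _ "North l # P"] exI[of _ Q]) simp
qed simp

lemma path_split_at_label:
  "wrow D = xs @ v # ys \<Longrightarrow> \<exists>P Q. D = P @ North v # Q \<and> wrow P = xs"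
proof (induction D arbitrary: xs rule: path_induct)
  case (East p)
  then have "wrow p = xs @ v # ys" by simp
  then obtain P Q where "p = P @ North v # Q" "wrow P = xs" using East.IH by blast
  then show ?case by (intro exI[of _ "East # P"] exI[of _ Q]) simp
next
  case (North l p)
  show ?case
  proof (cases xs)
    case Nil
    with North.prems show ?thesis by (intro exI[of _ "[]"] exI[of _ p]) simp
  next
    case (Cons x xs')
    with North.prems have "wrow p = xs' @ v # ys" "x = l" by auto
    moreover from this obtain P Q where "p = P @ North v # Q" "wrow P = xs'" using North.IH by blast
    ultimately show ?thesis using Cons by (intro exI[of _ "North l # P"] exI[of _ Q]) simp
  qed
qed simp

lemma dyck_prefix: "dyck_path n k (P @ Q) \<Longrightarrow> easts P \<le> k * norths P"
  unfolding dyck_path_def by (auto dest: spec[of _ "length P"])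

text \<open>The condition that \<open>f\<close> is \<open>f\<^sub>D\<close> for some path \<open>D\<close>: when the path has made \<open>m\<close> east steps, the
Dyck condition asks for \<open>m\<close> to be at most \<open>k\<close> times the height, and the height is the number of
labels in the first \<open>m\<close> columns. Only the points after an east step matter.\<close>

definition parking :: "nat \<Rightarrow> nat \<Rightarrow> (nat \<Rightarrow> nat) \<Rightarrow> bool" where
  "parking n k f \<longleftrightarrow> (\<forall>l\<in>{1..n}. 1 \<le> f l) \<and>
     (\<forall>m\<in>{1..k * n}. m \<le> k * card {l \<in> {1..n}. f l \<le> m})"

lemma parking_le:
  assumes "parking n k f" "1 \<le> m" "m \<le> k * n"
  shows "m \<le> k * card {l \<in> {1..n}. f l \<le> m}"
  using assms by (auto simp: parking_def)

lemma parking_pos: "parking n k f \<Longrightarrow> l \<in> {1..n} \<Longrightarrow> 1 \<le> f l"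
  by (simp add: parking_def)

lemma parking_f_pf:
  assumes D: "D \<in> PF n k"
  shows "parking n k (f_pf D)"
  unfolding parking_def
proof (intro conjI ballI)
  fix m assume m: "m \<in> {1..k * n}"
  have dyck: "dyck_path n k D" and dist: "distinct (wrow D)" and labels: "set (wrow D) = {1..n}"
    using D by (auto simp: PF_iff)
  \<comment> \<open>The prefix of \<open>D\<close> that ends with the \<open>m\<close>-th east step.\<close>
  have "m - 1 < easts D" using m dyck by (auto simp: dyck_path_def)
  then obtain P Q where D_eq: "D = P @ East # Q" and P: "easts P = m - 1"
    using East_step_exists by blast
  have "m \<le> k * norths P"
    using dyck_prefix[of n k "P @ [East]" Q] dyck m P by (simp add: D_eq)
  also have "norths P = card (set (wrow P))"
    using dist by (simp add: D_eq distinct_card)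
  also have "card (set (wrow P)) \<le> card {l \<in> {1..n}. f_pf D l \<le> m}"
  proof (intro card_mono subsetI)
    fix l assume l: "l \<in> set (wrow P)"
    then obtain x where x: "(x, l) \<in> set (points 0 P)" by (auto simp: set_wrow[of _ 0])
    then have "x = xpos D l" using xpos_points[of x l 0 D] dist by (simp add: D_eq)
    then show "l \<in> {l \<in> {1..n}. f_pf D l \<le> m}"
      using points_upper[OF x] P m l labels by (auto simp: D_eq f_pf_def)
  qed simp
  finally show "m \<le> k * card {l \<in> {1..n}. f_pf D l \<le> m}" by simp
qed (simp add: f_pf_def)

lemma PF_column_le:
  assumes D: "D \<in> PF n k" and split: "wrow D = xs @ v # ys"
  shows "f_pf D v \<le> k * length xs + 1"
proof -
  obtain P Q where PQ: "D = P @ North v # Q" "wrow P = xs"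
    using path_split_at_label[OF split] by blast
  have "(easts P, v) \<in> set (points 0 D)" by (simp add: PQ)
  then have "easts P = xpos D v" using xpos_points[of "easts P" v 0 D] D by (simp add: PF_iff)
  moreover have "easts P \<le> k * norths P" using dyck_prefix[of n k P "North v # Q"] D PQ by (simp add: PF_iff)
  moreover have "norths P = length xs" using PQ by (metis length_wrow)
  ultimately show ?thesis by (simp add: f_pf_def)
qed

definition column :: "nat \<Rightarrow> (nat \<Rightarrow> nat) \<Rightarrow> nat \<Rightarrow> nat list" where
  "column n f a = sorted_list_of_set {l \<in> {1..n}. f l = Suc a}"

text \<open>The first \<open>N\<close> columns of the path with columns \<open>f\<close>: each column is climbed, labels increasing,
before its east step.\<close>

primrec path_of :: "nat \<Rightarrow> (nat \<Rightarrow> nat) \<Rightarrow> nat \<Rightarrow> labelled_path" where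
  "path_of n f 0 = []"
| "path_of n f (Suc a) = path_of n f a @ map North (column n f a) @ [East]"

lemma easts_path_of [simp]: "easts (path_of n f N) = N"
  by (induction N) simp_all

lemma set_column: "set (column n f a) = {l \<in> {1..n}. f l = Suc a}"
  by (simp add: column_def)

lemma norths_path_of:
  assumes "\<forall>l\<in>{1..n}. 1 \<le> f l"
  shows "norths (path_of n f N) = card {l \<in> {1..n}. f l \<le> N}"
proof (induction N)
  case 0
  have "{l \<in> {1..n}. f l \<le> 0} = {}" using assms by fastforce
  then show ?case by (simp only: path_of.simps norths_simps card.empty)
next
  case (Suc N)
  have "{l \<in> {1..n}. f l \<le> Suc N} = {l \<in> {1..n}. f l \<le> N} \<union> {l \<in> {1..n}. f l = Suc N}" by auto
  then have "card {l \<in> {1..n}. f l \<le> Suc N} =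
      card {l \<in> {1..n}. f l \<le> N} + card {l \<in> {1..n}. f l = Suc N}"
    by (simp only:) (intro card_Un_disjoint, auto)
  with Suc show ?case by (simp add: column_def)
qed

lemma set_points_path_of:
  assumes "\<forall>l\<in>{1..n}. 1 \<le> f l"
  shows "set (points 0 (path_of n f N)) = (\<lambda>l. (f l - 1, l)) ` {l \<in> {1..n}. f l \<le> N}"
proof (induction N)
  case 0
  have "{l \<in> {1..n}. f l \<le> 0} = {}" using assms by fastforce
  then show ?case by (simp only: path_of.simps points.simps set_simps image_empty)
next
  case (Suc N)
  have "{l \<in> {1..n}. f l \<le> Suc N} = {l \<in> {1..n}. f l \<le> N} \<union> {l \<in> {1..n}. f l = Suc N}" by auto
  moreover have "Pair N ` {l \<in> {1..n}. f l = Suc N} = (\<lambda>l. (f l - 1, l)) ` {l \<in> {1..n}. f l = Suc N}"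
    by (intro image_cong) auto
  ultimately show ?case using Suc by (simp add: set_column image_Un)
qed

lemma sorted_points_path_of: "sorted_wrt (<) (points 0 (path_of n f N))"
proof (induction N)
  case (Suc N)
  have "sorted_wrt (<) (map (Pair N) (column n f N))"
    unfolding sorted_wrt_map column_def
    by (rule sorted_wrt_mono_rel[OF _ strict_sorted_list_of_set]) simp
  moreover have "x < N" if "(x, l) \<in> set (points 0 (path_of n f N))" for x l
    using that
  proof (induction N)
    case (Suc N)
    then show ?case by fastforce
  qed simp
  ultimately show ?case using Suc by (fastforce simp: sorted_wrt_append)
qed simp

lemma dyck_path_of:
  assumes f: "parking n k f" and k: "1 \<le> k"
  shows "dyck_path n k (path_of n f (k * n))"
proof (cases "k * n = 0")
  case False
  have pos: "\<forall>l\<in>{1..n}. 1 \<le> f l" using f by (simp add: parking_def)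
  have "k * n \<le> k * card {l \<in> {1..n}. f l \<le> k * n}"
    by (rule parking_le[OF f]) (use False in simp_all)
  then have "n \<le> card {l \<in> {1..n}. f l \<le> k * n}" using False by (simp only: mult_le_cancel1) simp
  moreover have "card {l \<in> {1..n}. f l \<le> k * n} \<le> card {1..n}" by (intro card_mono) auto
  ultimately have "norths (path_of n f (k * n)) = n" using norths_path_of[OF pos] by simp
  moreover have "easts (take m (path_of n f N)) \<le> k * norths (take m (path_of n f N))"
    if "N \<le> k * n" for m N
    using that
  proof (induction N arbitrary: m)
    case (Suc N)
    let ?P = "path_of n f N" and ?C = "map North (column n f N)"
    have low: "N \<le> k * norths ?P"
      using parking_le[OF f, of N] norths_path_of[OF pos, of N] Suc.prems by (cases "N = 0") auto
    have high: "Suc N \<le> k * norths (?P @ ?C)"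
      using parking_le[OF f, of "Suc N"] norths_path_of[OF pos, of "Suc N"] Suc.prems by simp
    consider "m \<le> length ?P" | "length ?P < m" "m \<le> length (?P @ ?C)" | "length (?P @ ?C) < m"
      by linarith
    then show ?case
    proof cases
      case 1
      then show ?thesis using Suc by simp
    next
      case 2
      then have "take m (path_of n f (Suc N)) = ?P @ map North (take (m - length ?P) (column n f N))"
        by (simp add: take_map)
      then show ?thesis using low by (simp add: add_mult_distrib2)
    next
      case 3
      then have "take m (path_of n f (Suc N)) = ?P @ ?C @ [East]" by simp
      then show ?thesis using high by simp
    qed
  qed simp
  ultimately show ?thesis by (auto simp: dyck_path_def)
qed (use k in \<open>simp add: dyck_path_def\<close>)

lemma PF_exists:
  assumes f: "parking n k f" and "1 \<le> k"
  obtains D where "D \<in> PF n k" "\<And>l. l \<in> {1..n} \<Longrightarrow> f_pf D l = f l"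
proof -
  let ?D = "path_of n f (k * n)"
  have pos: "\<forall>l\<in>{1..n}. 1 \<le> f l" using f by (simp add: parking_def)
  have dyck: "dyck_path n k ?D" using dyck_path_of[OF assms] .
  have "card {l \<in> {1..n}. f l \<le> k * n} = card {1..n}"
    using dyck norths_path_of[OF pos] by (simp add: dyck_path_def)
  then have all: "{l \<in> {1..n}. f l \<le> k * n} = {1..n}"
    by (intro card_subset_eq) auto
  have labels: "set (wrow ?D) = {1..n}"
    unfolding set_wrow[of _ 0] set_points_path_of[OF pos] all by (simp add: image_image)
  moreover have dist: "distinct (wrow ?D)"
    using labels dyck by (intro card_distinct) (simp add: dyck_path_def)
  ultimately have "?D \<in> PF n k" using dyck sorted_points_path_of by (simp add: PF_iff)
  moreover have "f_pf ?D l = f l" if "l \<in> {1..n}" for l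
  proof -
    have "(f l - 1, l) \<in> set (points 0 ?D)" using that unfolding set_points_path_of[OF pos] all by simp
    from xpos_points[OF this dist] show ?thesis using bspec[OF pos that] by (simp add: f_pf_def)
  qed
  ultimately show thesis using that by blast
qed

section \<open>Blocks\<close>

text \<open>Two vertices other than the sink are joined by \<open>k - 1\<close> edges if they share a block \<open>I\<^sub>j\<close> and by
\<open>k\<close> edges otherwise, so this relation carries all the structure of the graph. It relates no element of a block \<open>K\<^sub>i\<close> to anything,
itself included.\<close>

definition same_block :: "nat list \<Rightarrow> nat \<Rightarrow> nat \<Rightarrow> bool" where
  "same_block \<nu> u v \<longleftrightarrow> (\<exists>j<length \<nu>. u \<in> I_block \<nu> j \<and> v \<in> I_block \<nu> j)"

definition below :: "nat list \<Rightarrow> nat \<Rightarrow> nat set" where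
  "below \<nu> v = {u. u < v \<and> same_block \<nu> u v}"

definition above :: "nat list \<Rightarrow> nat \<Rightarrow> nat set" where
  "above \<nu> v = {u. v < u \<and> same_block \<nu> v u}"

lemma sum_list_take_mono: "i \<le> j \<Longrightarrow> sum_list (take i xs) \<le> sum_list (take j (xs :: nat list))"
  by (metis le_add1 le_add_diff_inverse sum_list_append take_add)

lemma I_block_disjoint:
  assumes "u \<in> I_block \<nu> i" "u \<in> I_block \<nu> j"
  shows "i = j"
proof (rule ccontr)
  assume "i \<noteq> j"
  then consider "Suc i \<le> j" | "Suc j \<le> i" by linarith
  then show False
    using assms sum_list_take_mono[of "Suc i" j \<nu>] sum_list_take_mono[of "Suc j" i \<nu>]
    by cases (auto simp: I_block_def)
qed

lemma same_block_sym: "same_block \<nu> u v \<Longrightarrow> same_block \<nu> v u"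
  by (auto simp: same_block_def)

lemma same_block_trans: "same_block \<nu> u v \<Longrightarrow> same_block \<nu> v w \<Longrightarrow> same_block \<nu> u w"
  unfolding same_block_def using I_block_disjoint by blast

lemma same_block_convex:
  "same_block \<nu> u w \<Longrightarrow> u \<le> v \<Longrightarrow> v \<le> w \<Longrightarrow> same_block \<nu> u v"
  by (auto simp: same_block_def I_block_def)

lemma same_block_range:
  assumes "same_block \<nu> u v"
  shows "u \<in> {1..sum_list \<nu>}" "v \<in> {1..sum_list \<nu>}"
proof -
  obtain j where j: "j < length \<nu>" "u \<in> I_block \<nu> j" "v \<in> I_block \<nu> j"
    using assms by (auto simp: same_block_def)
  have "sum_list (take (Suc j) \<nu>) \<le> sum_list \<nu>"
    using sum_list_take_mono[of "Suc j" "length \<nu>" \<nu>] j by simp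
  then show "u \<in> {1..sum_list \<nu>}" "v \<in> {1..sum_list \<nu>}"
    using j by (auto simp: I_block_def)
qed

lemma below_mono: "same_block \<nu> u v \<Longrightarrow> u < v \<Longrightarrow> insert u (below \<nu> u) \<subseteq> below \<nu> v"
  by (auto simp: below_def intro: same_block_trans)

lemma finite_below [simp]: "finite (below \<nu> v)"
  by (rule finite_subset[of _ "{..<v}"]) (auto simp: below_def)

lemma finite_above [simp]: "finite (above \<nu> v)"
  by (rule finite_subset[of _ "{1..sum_list \<nu>}"])
    (auto simp: above_def dest: same_block_range(2))

lemma above_same_block:
  assumes "x \<in> above \<nu> v" "y \<in> above \<nu> v"
  shows "same_block \<nu> x y"
proof (rule same_block_trans)
  show "same_block \<nu> x v" "same_block \<nu> v y"
    using assms by (simp_all add: above_def same_block_sym)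
qed

lemma below_same_block:
  assumes "x \<in> below \<nu> v" "y \<in> below \<nu> v"
  shows "same_block \<nu> x y"
proof (rule same_block_trans)
  show "same_block \<nu> x v" "same_block \<nu> v y"
    using assms by (simp_all add: below_def same_block_sym)
qed

definition block_decreasing :: "nat list \<Rightarrow> (nat \<Rightarrow> nat) \<Rightarrow> bool" where
  "block_decreasing \<nu> f \<longleftrightarrow> (\<forall>u v. u < v \<and> same_block \<nu> u v \<longrightarrow> f v < f u)"

lemma block_decreasingD: "block_decreasing \<nu> f \<Longrightarrow> u < v \<Longrightarrow> same_block \<nu> u v \<Longrightarrow> f v < f u"
  by (simp add: block_decreasing_def)

text \<open>A strictly monotone function is injective on a block, so a window of its values bounds the number of
elements. All estimates that compare \<open>f\<close> with numbers of block elements come from this.\<close>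

lemma card_block_le:
  assumes f: "block_decreasing \<nu> f" and A: "\<forall>u\<in>A. \<forall>v\<in>A. u \<noteq> v \<longrightarrow> same_block \<nu> u v"
    and range: "f ` A \<subseteq> {a..<b}"
  shows "card A \<le> b - a"
proof -
  have "inj_on f A"
  proof (rule inj_onI, rule ccontr)
    fix u v assume "u \<in> A" "v \<in> A" "f u = f v" "u \<noteq> v"
    then show False
      using A block_decreasingD[OF f, of u v] block_decreasingD[OF f, of v u]
      by (cases u v rule: linorder_cases) force+
  qed
  then have "card A = card (f ` A)" by (simp add: card_image)
  also have "\<dots> \<le> card {a..<b}" using range by (intro card_mono) auto
  finally show ?thesis by simp
qed

locale shuffle_graph =
  fixes n k :: nat and \<mu> \<nu> :: "nat list"
  assumes n: "1 \<le> n" and k: "1 \<le> k" and size: "sum_list \<mu> + sum_list \<nu> = n"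
begin

abbreviation "\<epsilon> \<equiv> G_mult n k \<nu>"

text \<open>The column that \<open>\<Gamma>\<close> assigns to \<open>v\<close>. In the run of the delay algorithm, with the grain
releases numbered from 1, it is the number of the earliest release that \<open>v\<close> can make.\<close>

definition start_column :: "config \<Rightarrow> nat \<Rightarrow> int" where
  "start_column c v = (int n - 1) * int k - c v - int (card (below \<nu> v)) + 1"

lemma same_block_vertex: "same_block \<nu> u v \<Longrightarrow> u \<in> {1..n}" "same_block \<nu> u v \<Longrightarrow> v \<in> {1..n}"
  using same_block_range[of \<nu> u v] size by auto

lemma mult_vertices:
  assumes "u \<in> {1..n}" "v \<in> {1..n}" "u \<noteq> v"
  shows "int (\<epsilon> u v) = int k - (if same_block \<nu> u v then 1 else 0)"
  using assms k by (auto simp: G_mult_def same_block_def)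

lemma mult_sink: "v \<in> {1..n} \<Longrightarrow> \<epsilon> 0 v = 1" "v \<in> {1..n} \<Longrightarrow> \<epsilon> v 0 = 1"
  by (auto simp: G_mult_def)

lemma sum_mult:
  assumes "v \<in> {1..n}" "A \<subseteq> {1..n}" "v \<notin> A"
  shows "(\<Sum>u\<in>A. int (\<epsilon> u v)) = int k * int (card A) - int (card {u \<in> A. same_block \<nu> u v})"
proof -
  have fin: "finite A" using assms finite_subset by blast
  have "(\<Sum>u\<in>A. int (\<epsilon> u v)) = (\<Sum>u\<in>A. int k - (if same_block \<nu> u v then 1 else 0))"
    using assms by (intro sum.cong mult_vertices) auto
  also have "\<dots> = int k * int (card A) - (\<Sum>u\<in>A. if same_block \<nu> u v then 1 else 0)"
    by (simp add: sum_subtractf)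
  also have "(\<Sum>u\<in>A. if same_block \<nu> u v then 1 else 0) = int (card {u \<in> A. same_block \<nu> u v})"
    using fin by (simp add: sum.If_cases Int_def)
  finally show ?thesis .
qed

lemma mult_commute: "\<epsilon> u v = \<epsilon> v u"
  by (auto simp: G_mult_def)

lemma block_partition:
  "{u \<in> {1..n} - {v}. same_block \<nu> u v} = below \<nu> v \<union> above \<nu> v" "below \<nu> v \<inter> above \<nu> v = {}"
proof -
  show "{u \<in> {1..n} - {v}. same_block \<nu> u v} = below \<nu> v \<union> above \<nu> v"
    using same_block_vertex by (fastforce simp: below_def above_def intro: same_block_sym)
qed (auto simp: below_def above_def)

lemma deg_eq:
  assumes v: "v \<in> {1..n}"
  shows "int (deg n \<epsilon> v) =
    int k * (int n - 1) - int (card (below \<nu> v)) - int (card (above \<nu> v)) + 1"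
proof -
  have "{0..n} - {v} = insert 0 ({1..n} - {v})" using v by auto
  then have "int (deg n \<epsilon> v) = int (\<epsilon> v 0) + (\<Sum>w\<in>{1..n} - {v}. int (\<epsilon> v w))"
    by (simp add: deg_def)
  also have "(\<Sum>w\<in>{1..n} - {v}. int (\<epsilon> v w)) = (\<Sum>w\<in>{1..n} - {v}. int (\<epsilon> w v))"
    by (intro sum.cong arg_cong[where f = int] mult_commute) simp
  also have "\<dots> = int k * int (card ({1..n} - {v})) - int (card (below \<nu> v \<union> above \<nu> v))"
    using sum_mult[of v "{1..n} - {v}"] v unfolding block_partition(1) by blast
  also have "card (below \<nu> v \<union> above \<nu> v) = card (below \<nu> v) + card (above \<nu> v)"
    by (intro card_Un_disjoint finite_below finite_above block_partition)
  also have "card ({1..n} - {v}) = n - 1" using v by simp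
  finally show ?thesis using v n by (simp add: mult_sink of_nat_diff)
qed

lemma K_block_not_I_block:
  assumes "v \<in> K_block n \<mu> i"
  shows "\<not> same_block \<nu> u v"
proof
  assume "same_block \<nu> u v"
  then have "v \<le> sum_list \<nu>" using same_block_range(2) by auto
  moreover have "sum_list (take (Suc i) \<mu>) \<le> sum_list \<mu>"
    using sum_list_take_mono[of "Suc i" "max (Suc i) (length \<mu>)" \<mu>] by simp
  ultimately show False using assms size by (auto simp: K_block_def)
qed

lemma K_block_vertex: "v \<in> K_block n \<mu> i \<Longrightarrow> v \<in> {1..n}"
  by (auto simp: K_block_def)

text \<open>The case distinction in the embedding disappears because an element of \<open>K\<^sub>i\<close> has no block element
below it.\<close>

lemma embed_eq:
  assumes "v \<in> {1..n}"
  shows "embed n \<mu> \<nu> c v = c v + int (card (below \<nu> v))"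
proof (cases "\<exists>i<length \<mu>. v \<in> K_block n \<mu> i")
  case True
  then have "below \<nu> v = {}" using K_block_not_I_block by (auto simp: below_def)
  with True show ?thesis using assms by (simp add: embed_def)
next
  case False
  show ?thesis
    unfolding embed_def restrict_apply'[OF assms] if_not_P[OF False] below_def same_block_def ..
qed

lemma Gamma_rel_iff:
  "Gamma_rel n k \<mu> \<nu> c D \<longleftrightarrow> D \<in> PF n k \<and> (\<forall>v\<in>{1..n}. int (f_pf D v) = start_column c v)"
  unfolding Gamma_rel_def start_column_def by (auto simp: embed_eq)

text \<open>From \<open>c\<close> to \<open>f\<close>: between \<open>u < v\<close> in a block, the number of smaller block elements grows by at
least one. From \<open>f\<close> to \<open>c\<close>: it grows by the number of block elements in \<open>{u..<v}\<close>, and \<open>f\<close>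
decreases by at least as much, since these elements have distinct columns.\<close>

lemma block_increasing_iff:
  assumes f: "\<forall>v\<in>{1..n}. int (f v) = start_column c v"
  shows "(\<forall>j<length \<nu>. monotone_on (I_block \<nu> j) (\<le>) (\<le>) c) \<longleftrightarrow> block_decreasing \<nu> f"
proof -
  have "(\<forall>j<length \<nu>. monotone_on (I_block \<nu> j) (\<le>) (\<le>) c) \<longleftrightarrow>
      (\<forall>u v. u \<le> v \<and> same_block \<nu> u v \<longrightarrow> c u \<le> c v)"
    by (auto simp: monotone_on_def same_block_def)
  also have "\<dots> \<longleftrightarrow> block_decreasing \<nu> f"
  proof
    assume c: "\<forall>u v. u \<le> v \<and> same_block \<nu> u v \<longrightarrow> c u \<le> c v"
    show "block_decreasing \<nu> f"
      unfolding block_decreasing_def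
    proof (intro allI impI, elim conjE)
      fix u v assume uv: "u < v" "same_block \<nu> u v"
      have "card (insert u (below \<nu> u)) \<le> card (below \<nu> v)"
        using uv by (intro card_mono below_mono) auto
      then have "card (below \<nu> u) < card (below \<nu> v)" by (simp add: below_def)
      moreover have "c u \<le> c v" using c uv by simp
      moreover have "int (f u) = start_column c u" "int (f v) = start_column c v"
        using f same_block_vertex uv(2) by blast+
      ultimately show "f v < f u" by (simp add: start_column_def)
    qed
  next
    assume dec: "block_decreasing \<nu> f"
    show "\<forall>u v. u \<le> v \<and> same_block \<nu> u v \<longrightarrow> c u \<le> c v"
    proof (intro allI impI, elim conjE)
      fix u v assume uv: "u \<le> v" "same_block \<nu> u v"
      show "c u \<le> c v"
      proof (cases "u = v")
        case False
        then have "u < v" using uv by simp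
        then have sub: "below \<nu> u \<subseteq> below \<nu> v" using below_mono uv by blast
        let ?A = "below \<nu> v - below \<nu> u"
        have A: "u \<le> w" "w < v" "same_block \<nu> w v" if "w \<in> ?A" for w
          using that uv by (auto simp: below_def not_less intro: same_block_trans same_block_sym)
        have "card ?A \<le> Suc (f u) - Suc (f v)"
        proof (rule card_block_le[OF dec])
          show "\<forall>x\<in>?A. \<forall>y\<in>?A. x \<noteq> y \<longrightarrow> same_block \<nu> x y"
            using A by (blast intro: same_block_trans same_block_sym)
          show "f ` ?A \<subseteq> {Suc (f v)..<Suc (f u)}"
          proof clarify
            fix w assume "w \<in> below \<nu> v" "w \<notin> below \<nu> u"
            then have w: "u \<le> w" "w < v" "same_block \<nu> w v" using A by auto
            then have "f v < f w" using block_decreasingD[OF dec] by blast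
            moreover have "f w \<le> f u"
              using w block_decreasingD[OF dec, of u w] same_block_convex[OF uv(2)]
              by (cases "u = w") auto
            ultimately show "f w \<in> {Suc (f v)..<Suc (f u)}" by simp
          qed
        qed
        moreover have "card ?A = card (below \<nu> v) - card (below \<nu> u)"
          using sub by (intro card_Diff_subset) auto
        moreover have "card (below \<nu> u) \<le> card (below \<nu> v)" using sub by (intro card_mono) auto
        moreover have "f v < f u" using block_decreasingD[OF dec \<open>u < v\<close>] uv by blast
        moreover have "int (f u) = start_column c u" "int (f v) = start_column c v"
          using f same_block_vertex uv(2) by blast+
        ultimately show ?thesis by (simp add: start_column_def)
      qed simp
    qed
  qed
  finally show ?thesis .
qed

lemma topple_apply:
  "v \<in> {1..n} \<Longrightarrow>
    topple n \<epsilon> t c v = (if v = t then c v - int (deg n \<epsilon> t) else c v + int (\<epsilon> t v))"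
  by (simp add: topple_def)

section \<open>Recurrent configurations and parking functions\<close>

lemma fold_topple:
  assumes "distinct T" "set T \<subseteq> {1..n}" "v \<in> {1..n}"
  shows "fold (topple n \<epsilon>) T c v =
    c v + (\<Sum>u\<in>set T - {v}. int (\<epsilon> u v)) - (if v \<in> set T then int (deg n \<epsilon> v) else 0)"
  using assms
proof (induction T rule: rev_induct)
  case (snoc t T)
  have IH: "fold (topple n \<epsilon>) T c v =
      c v + (\<Sum>u\<in>set T - {v}. int (\<epsilon> u v)) - (if v \<in> set T then int (deg n \<epsilon> v) else 0)"
    using snoc by simp
  show ?case
  proof (cases "t = v")
    case True
    then have "set (T @ [t]) - {v} = set T - {v}" by auto
    moreover have "fold (topple n \<epsilon>) (T @ [t]) c v = fold (topple n \<epsilon>) T c v - int (deg n \<epsilon> v)"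
      using True snoc.prems by (simp add: topple_apply)
    ultimately show ?thesis using True snoc.prems by (simp add: IH)
  next
    case False
    then have "set (T @ [t]) - {v} = insert t (set T - {v})" by auto
    moreover have "fold (topple n \<epsilon>) (T @ [t]) c v = fold (topple n \<epsilon>) T c v + int (\<epsilon> t v)"
      using False snoc.prems by (simp add: topple_apply)
    ultimately show ?thesis using False snoc.prems by (simp add: IH)
  qed
qed simp

lemma topple_sink: "v \<in> {1..n} \<Longrightarrow> topple n \<epsilon> 0 c v = c v + 1"
  by (simp add: topple_apply mult_sink)

text \<open>The surplus of \<open>v\<close> over its degree, once the sink and the vertices in \<open>T\<close> have toppled. The
elements of the block below \<open>v\<close> cancel between the degree and \<open>start_column\<close>.\<close>

lemma toppled_value:
  assumes T: "distinct T" "set T \<subseteq> {1..n}" and v: "v \<in> {1..n}" "v \<notin> set T"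
  shows "fold (topple n \<epsilon>) T (topple n \<epsilon> 0 c) v - int (deg n \<epsilon> v) =
    int k * int (length T) + int (card (above \<nu> v)) - int (card {u \<in> set T. same_block \<nu> u v})
      - (start_column c v - 1)"
proof -
  have "set T - {v} = set T" using v by simp
  then have "fold (topple n \<epsilon>) T (topple n \<epsilon> 0 c) v =
      c v + 1 + int k * int (length T) - int (card {u \<in> set T. same_block \<nu> u v})"
    using v T sum_mult[of v "set T"] by (simp add: fold_topple topple_sink distinct_card)
  then show ?thesis unfolding deg_eq[OF v(1)] start_column_def by (simp add: algebra_simps)
qed

end

text \<open>Columns decrease strictly along a block, so the block elements above \<open>v\<close> are read before \<open>v\<close> and
those below are read after it.\<close>

lemma wrow_block_prefix:
  assumes D: "D \<in> PF n k" and split: "wrow D = xs @ v # ys"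
    and dec: "block_decreasing \<nu> (f_pf D)"
    and vertices: "\<And>u. same_block \<nu> u v \<Longrightarrow> u \<in> {1..n}"
  shows "{u \<in> set xs. same_block \<nu> u v} = above \<nu> v"
proof -
  have sorted: "sorted_wrt (\<lambda>u v. (f_pf D u, u) < (f_pf D v, v)) (xs @ v # ys)"
    using PF_wrow_sorted[OF D] split by simp
  then have before: "(f_pf D u, u) < (f_pf D v, v)" if "u \<in> set xs" for u
    using that by (simp add: sorted_wrt_append)
  have after: "(f_pf D v, v) < (f_pf D u, u)" if "u \<in> set ys" for u
    using that sorted by (simp add: sorted_wrt_append)
  have "u \<in> above \<nu> v" if "u \<in> set xs" "same_block \<nu> u v" for u
    using before[OF that(1)] block_decreasingD[OF dec, of u v] that(2)
    by (cases u v rule: linorder_cases) (auto simp: above_def intro: same_block_sym)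
  moreover have "u \<in> set xs \<and> same_block \<nu> u v" if "u \<in> above \<nu> v" for u
  proof -
    have "v < u" "same_block \<nu> v u" using that by (auto simp: above_def)
    then have "f_pf D u < f_pf D v" "u \<in> set (wrow D)"
      using block_decreasingD[OF dec] vertices same_block_sym D by (auto simp: PF_iff)
    then have "u \<in> set xs" using after[of u] \<open>v < u\<close> by (auto simp: split)
    then show ?thesis using same_block_sym[OF \<open>same_block \<nu> v u\<close>] ..
  qed
  ultimately show ?thesis by blast
qed

context shuffle_graph
begin

text \<open>Suppose that \<open>m > k |C|\<close>, where \<open>C\<close> is the set of vertices with column at most \<open>m\<close>, and let \<open>v\<close>
be the first vertex outside \<open>C\<close> in a toppling order. All vertices toppled before \<open>v\<close> lie in
\<open>C\<close>, and toppling the rest of \<open>C\<close> as well can only add grains to \<open>v\<close>. Its surplus is therefore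
at most \<open>k |C| - (f v - 1) + w\<close>, where \<open>w\<close> counts the elements of its block above \<open>v\<close>
outside \<open>C\<close>. Their columns are distinct and lie strictly between \<open>m\<close> and \<open>f v\<close>, so
\<open>w \<le> f v - m - 1\<close> and the surplus is at most \<open>k |C| - m < 0\<close>.\<close>

lemma recurrent_imp_parking:
  assumes rec: "recurrent n \<epsilon> c" and f: "\<forall>v\<in>{1..n}. int (f v) = start_column c v"
    and dec: "block_decreasing \<nu> f"
  shows "\<forall>m\<in>{1..k * n}. m \<le> k * card {v \<in> {1..n}. f v \<le> m}"
proof (rule ballI, rule ccontr)
  fix m assume m: "m \<in> {1..k * n}" and "\<not> m \<le> k * card {v \<in> {1..n}. f v \<le> m}"
  define C where "C = {v \<in> {1..n}. f v \<le> m}"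
  define S where "S = {v \<in> {1..n}. m < f v}"
  have less: "k * card C < m" using \<open>\<not> _\<close> by (simp add: C_def)
  have "C \<noteq> {1..n}" using less m by auto
  then have "S \<noteq> {}" by (auto simp: C_def S_def)
  obtain \<tau> where \<tau>: "distinct \<tau>" "set \<tau> = {1..n}"
    and legal: "\<And>i. i \<le> n \<Longrightarrow> nonneg n (fold (topple n \<epsilon>) (take i \<tau>) (topple n \<epsilon> 0 c))"
    using rec unfolding recurrent_def by blast
  have len: "length \<tau> = n" using distinct_card[OF \<tau>(1)] \<tau>(2) by simp
  have "\<exists>v\<in>set \<tau>. v \<in> S" using \<open>S \<noteq> {}\<close> \<tau>(2) by (auto simp: S_def)
  then obtain T v R where split: "\<tau> = T @ v # R" and v: "v \<in> S" and T: "\<forall>u\<in>set T. u \<notin> S"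
    using split_list_first_prop[of \<tau> "\<lambda>v. v \<in> S"] by blast
  have vn: "v \<in> {1..n}" using v by (simp add: S_def)
  have T_dist: "distinct T" and T_sub: "set T \<subseteq> {1..n}" and vT: "v \<notin> set T"
    using \<tau> split by auto
  have T_C: "set T \<subseteq> C" using T T_sub by (fastforce simp: C_def S_def)
  have "take (Suc (length T)) \<tau> = T @ [v]" "Suc (length T) \<le> n" using split len by auto
  then have "0 \<le> fold (topple n \<epsilon>) (T @ [v]) (topple n \<epsilon> 0 c) v"
    using legal[of "Suc (length T)"] vn by (simp add: nonneg_def)
  then have "int (deg n \<epsilon> v) \<le> fold (topple n \<epsilon>) T (topple n \<epsilon> 0 c) v"
    using vn by (simp add: topple_apply)
  then have f_v: "int (f v) - 1 \<le> int k * int (length T) + int (card (above \<nu> v))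
      - int (card {u \<in> set T. same_block \<nu> u v})"
    using toppled_value[OF T_dist T_sub vn vT, of c] f vn by fastforce
  \<comment> \<open>A vertex of \<open>C\<close> contributes \<open>k\<close> or \<open>k - 1\<close> edges, neither of which is negative.\<close>
  have "int k * int (length T) - int (card {u \<in> set T. same_block \<nu> u v}) \<le>
      int k * int (card C) - int (card {u \<in> C. same_block \<nu> u v})"
  proof -
    have fin: "finite C" by (simp add: C_def)
    have "card C = card (set T) + card (C - set T)"
      using fin T_C by (metis card_Diff_subset card_mono finite_set le_add_diff_inverse)
    moreover have "card {u \<in> C. same_block \<nu> u v} =
        card {u \<in> set T. same_block \<nu> u v} + card {u \<in> C - set T. same_block \<nu> u v}"
      using fin T_C by (subst card_Un_disjoint[symmetric]) (auto intro: arg_cong[where f = card])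
    moreover have "card {u \<in> C - set T. same_block \<nu> u v} \<le> card (C - set T)"
      using fin by (intro card_mono) auto
    moreover have "int (card (C - set T)) \<le> int k * int (card (C - set T))"
      using k mult_right_mono[of 1 "int k" "int (card (C - set T))"] by simp
    moreover have "length T = card (set T)" using T_dist by (simp add: distinct_card)
    ultimately show ?thesis by (simp add: algebra_simps)
  qed
  moreover have "int k * int (card C) < int m" using less by (metis of_nat_less_iff of_nat_mult)
  ultimately have "f v + card {u \<in> C. same_block \<nu> u v} \<le> m + card (above \<nu> v)"
    using f_v by linarith
  moreover have "card (above \<nu> v) \<le> card {u \<in> C. same_block \<nu> u v} + card (above \<nu> v \<inter> S)"
  proof -
    have "above \<nu> v \<subseteq> {u \<in> C. same_block \<nu> u v} \<union> (above \<nu> v \<inter> S)"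
      using same_block_vertex by (fastforce simp: above_def C_def S_def intro: same_block_sym)
    then have "card (above \<nu> v) \<le> card ({u \<in> C. same_block \<nu> u v} \<union> (above \<nu> v \<inter> S))"
      by (intro card_mono) (auto simp: C_def)
    then show ?thesis using card_Un_le le_trans by blast
  qed
  moreover have "card (above \<nu> v \<inter> S) \<le> f v - Suc m"
  proof (rule card_block_le[OF dec])
    show "\<forall>x\<in>above \<nu> v \<inter> S. \<forall>y\<in>above \<nu> v \<inter> S. x \<noteq> y \<longrightarrow> same_block \<nu> x y"
      by (blast intro: above_same_block)
    show "f ` (above \<nu> v \<inter> S) \<subseteq> {Suc m..<f v}"
      using block_decreasingD[OF dec] by (auto simp: above_def S_def)
  qed
  moreover have "m < f v" using v by (simp add: S_def)
  ultimately show False by linarith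
qed

lemma stable_start_column:
  assumes "stable n \<epsilon> c" "v \<in> {1..n}"
  shows "1 \<le> start_column c v"
proof -
  have "c v < int (deg n \<epsilon> v)" using assms by (simp add: stable_def)
  then show ?thesis unfolding deg_eq[OF assms(2)] start_column_def by (simp add: algebra_simps)
qed

text \<open>By the counting condition at \<open>m = k (n - 1) + 1\<close>, more than \<open>n - 1\<close> vertices have column at most
\<open>m\<close>.\<close>

lemma parking_last_column:
  assumes f: "parking n k f" and v: "v \<in> {1..n}"
  shows "f v \<le> k * (n - 1) + 1"
proof -
  have "k * (n - 1) + 1 \<le> k * n" using n k by (cases n) auto
  then have "k * (n - 1) + 1 \<le> k * card {l \<in> {1..n}. f l \<le> k * (n - 1) + 1}"
    by (intro parking_le[OF f]) auto
  then have "k * (n - 1) < k * card {l \<in> {1..n}. f l \<le> k * (n - 1) + 1}" by linarith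
  then have "n - 1 < card {l \<in> {1..n}. f l \<le> k * (n - 1) + 1}" by simp
  then have "card {1..n} \<le> card {l \<in> {1..n}. f l \<le> k * (n - 1) + 1}" by simp
  then have "{l \<in> {1..n}. f l \<le> k * (n - 1) + 1} = {1..n}" by (intro card_seteq) auto
  then show ?thesis using v by blast
qed

text \<open>Stability says that the elements of the block above \<open>v\<close> fit into the columns before \<open>f v\<close>, and
non-negativity that those below \<open>v\<close> fit into the columns after \<open>f v\<close>, up to \<open>k (n - 1) + 1\<close>.\<close>

lemma parking_imp_stable_nonneg:
  assumes f: "\<forall>v\<in>{1..n}. int (f v) = start_column c v" and dec: "block_decreasing \<nu> f"
    and park: "parking n k f"
  shows "stable n \<epsilon> c" "nonneg n c"
proof -
  show "stable n \<epsilon> c"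
    unfolding stable_def
  proof
    fix v assume v: "v \<in> {1..n}"
    have "card (above \<nu> v) \<le> f v - 1"
    proof (rule card_block_le[OF dec])
      show "\<forall>x\<in>above \<nu> v. \<forall>y\<in>above \<nu> v. x \<noteq> y \<longrightarrow> same_block \<nu> x y"
        by (blast intro: above_same_block)
      have "f w \<in> {1..<f v}" if "w \<in> above \<nu> v" for w
        using that block_decreasingD[OF dec, of v w] parking_pos[OF park] same_block_vertex(2)[of v w]
        by (fastforce simp: above_def)
      then show "f ` above \<nu> v \<subseteq> {1..<f v}" by blast
    qed
    moreover have "1 \<le> f v" by (rule parking_pos[OF park v])
    moreover have "int (f v) = start_column c v" using f v by blast
    ultimately show "c v < int (deg n \<epsilon> v)"
      unfolding deg_eq[OF v] by (simp add: start_column_def algebra_simps)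
  qed
  show "nonneg n c"
    unfolding nonneg_def
  proof
    fix v assume v: "v \<in> {1..n}"
    have "card (below \<nu> v) \<le> k * (n - 1) + 2 - Suc (f v)"
    proof (rule card_block_le[OF dec])
      show "\<forall>x\<in>below \<nu> v. \<forall>y\<in>below \<nu> v. x \<noteq> y \<longrightarrow> same_block \<nu> x y"
        by (blast intro: below_same_block)
      have "f w \<in> {Suc (f v)..<k * (n - 1) + 2}" if "w \<in> below \<nu> v" for w
      proof -
        have w: "w < v" "same_block \<nu> w v" using that by (auto simp: below_def)
        then have "f v < f w" using block_decreasingD[OF dec] by blast
        moreover have "f w \<le> k * (n - 1) + 1"
          by (rule parking_last_column[OF park same_block_vertex(1)[OF w(2)]])
        ultimately show ?thesis by simp
      qed
      then show "f ` below \<nu> v \<subseteq> {Suc (f v)..<k * (n - 1) + 2}" by blast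
    qed
    moreover have "f v \<le> k * (n - 1) + 1" by (rule parking_last_column[OF park v])
    ultimately have "card (below \<nu> v) + f v \<le> k * (n - 1) + 1" by linarith
    then have "int (card (below \<nu> v)) + int (f v) \<le> int k * (int n - 1) + 1"
      using n by (metis of_nat_1 of_nat_add of_nat_diff of_nat_le_iff of_nat_mult)
    moreover have "int (f v) = start_column c v" using f v by blast
    ultimately show "0 \<le> c v" by (simp add: start_column_def algebra_simps)
  qed
qed

text \<open>The vertices topple in the order of the row word. A vertex that has not toppled holds at least its
initial number of grains, and one that has toppled was unstable at that time, by the Dyck condition
at its step.\<close>

lemma parking_imp_recurrent:
  assumes D: "D \<in> PF n k" and f: "\<forall>v\<in>{1..n}. int (f_pf D v) = start_column c v"
    and dec: "block_decreasing \<nu> (f_pf D)"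
  shows "recurrent n \<epsilon> c"
  unfolding recurrent_def
proof (intro conjI exI[of _ "wrow D"] allI impI)
  have park: "parking n k (f_pf D)" by (rule parking_f_pf[OF D])
  show "stable n \<epsilon> c" and c: "nonneg n c" using parking_imp_stable_nonneg[OF f dec park] by auto
  show dist: "distinct (wrow D)" and labels: "set (wrow D) = {1..n}" using D by (auto simp: PF_iff)
  fix m assume "m \<le> n"
  show "nonneg n (fold (topple n \<epsilon>) (take m (wrow D)) (topple n \<epsilon> 0 c))"
    unfolding nonneg_def
  proof
    fix v assume v: "v \<in> {1..n}"
    let ?c = "topple n \<epsilon> 0 c"
    have T: "distinct (take m (wrow D))" "set (take m (wrow D)) \<subseteq> {1..n}"
      using dist labels set_take_subset[of m "wrow D"] by auto
    show "0 \<le> fold (topple n \<epsilon>) (take m (wrow D)) ?c v"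
    proof (cases "v \<in> set (take m (wrow D))")
      case False
      have "0 \<le> ?c v" using c v by (simp add: topple_sink nonneg_def)
      then show ?thesis using False T v by (simp add: fold_topple sum_nonneg)
    next
      case True
      then obtain T1 T2 where T12: "take m (wrow D) = T1 @ v # T2" by (meson split_list)
      then have split: "wrow D = T1 @ v # (T2 @ drop m (wrow D))"
        by (metis append_Cons append_assoc append_take_drop_id)
      have T1: "distinct T1" "set T1 \<subseteq> {1..n}" "v \<notin> set T1" using T T12 by auto
      have "{u \<in> set T1. same_block \<nu> u v} = above \<nu> v"
        using wrow_block_prefix[OF D split dec] same_block_vertex(1) by blast
      moreover have "int (f_pf D v) \<le> int k * int (length T1) + 1"
        using PF_column_le[OF D split] by (metis of_nat_1 of_nat_add of_nat_le_iff of_nat_mult)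
      moreover have "int (f_pf D v) = start_column c v" using f v by blast
      ultimately have "0 \<le> fold (topple n \<epsilon>) T1 ?c v - int (deg n \<epsilon> v)"
        unfolding toppled_value[OF T1(1,2) v T1(3)] by simp
      also have "\<dots> \<le> fold (topple n \<epsilon>) (take m (wrow D)) ?c v"
      proof -
        have "(\<Sum>u\<in>set T1 - {v}. int (\<epsilon> u v)) \<le> (\<Sum>u\<in>set (take m (wrow D)) - {v}. int (\<epsilon> u v))"
          by (intro sum_mono2) (auto simp: T12)
        then show ?thesis
          unfolding fold_topple[OF T v] fold_topple[OF T1(1,2) v] using True T1 by simp
      qed
      finally show ?thesis .
    qed
  qed
qed

end

section \<open>The bijection, level and area\<close>

lemma sorted_wrt_subrelation_iff:
  assumes "sorted_wrt S xs" and asym: "\<And>u v. S u v \<Longrightarrow> \<not> S v u"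
  shows "sorted_wrt R xs \<longleftrightarrow> (\<forall>u\<in>set xs. \<forall>v\<in>set xs. S u v \<longrightarrow> R u v)"
  using assms(1)
proof (induction xs)
  case (Cons x xs)
  then show ?case using asym by auto
qed simp

text \<open>The order of two labels in the row word is the lexicographic order of their pairs of column and label.\<close>

lemma wrow_filter_sorted_iff:
  assumes D: "D \<in> PF n k" and A: "A \<subseteq> {1..n}"
  shows "sorted_wrt R (filter (\<lambda>l. l \<in> A) (wrow D)) \<longleftrightarrow>
    (\<forall>u\<in>A. \<forall>v\<in>A. (f_pf D u, u) < (f_pf D v, v) \<longrightarrow> R u v)"
proof -
  have "sorted_wrt (\<lambda>u v. (f_pf D u, u) < (f_pf D v, v)) (filter (\<lambda>l. l \<in> A) (wrow D))"
    by (rule sorted_wrt_filter[OF PF_wrow_sorted[OF D]])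
  then have "sorted_wrt R (filter (\<lambda>l. l \<in> A) (wrow D)) \<longleftrightarrow>
      (\<forall>u\<in>set (filter (\<lambda>l. l \<in> A) (wrow D)). \<forall>v\<in>set (filter (\<lambda>l. l \<in> A) (wrow D)).
        (f_pf D u, u) < (f_pf D v, v) \<longrightarrow> R u v)"
    by (rule sorted_wrt_subrelation_iff) (rule order_less_not_sym)
  moreover have "set (filter (\<lambda>l. l \<in> A) (wrow D)) = A" using D A by (auto simp: PF_iff)
  ultimately show ?thesis by (simp only:)
qed

lemma lex_less_imp_greater_iff:
  "((f u, u) < (f v, v) \<longrightarrow> v < u) \<longleftrightarrow> (u < v \<longrightarrow> f v < f u)" for u v :: nat and f :: "nat \<Rightarrow> nat"
  by (cases u v rule: linorder_cases) auto

lemma lex_less_imp_less_iff: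
  "((f u, u) < (f v, v) \<longrightarrow> u < v) \<longleftrightarrow> (v \<le> u \<longrightarrow> f v \<le> f u)" for u v :: nat and f :: "nat \<Rightarrow> nat"
  by (cases u v rule: linorder_cases) auto

context shuffle_graph
begin

lemma I_block_vertex: "v \<in> I_block \<nu> j \<Longrightarrow> j < length \<nu> \<Longrightarrow> v \<in> {1..n}"
  by (rule same_block_vertex(1)[of v v]) (auto simp: same_block_def)

lemma PF_shuffle_iff:
  "D \<in> PF_shuffle n k \<mu> \<nu> \<longleftrightarrow> D \<in> PF n k \<and> block_decreasing \<nu> (f_pf D) \<and>
     (\<forall>i<length \<mu>. monotone_on (K_block n \<mu> i) (\<le>) (\<le>) (f_pf D))"
proof (cases "D \<in> PF n k")
  case True
  have I: "sorted_wrt (>) (filter (\<lambda>l. l \<in> I_block \<nu> j) (wrow D)) \<longleftrightarrow>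
      (\<forall>u\<in>I_block \<nu> j. \<forall>v\<in>I_block \<nu> j. u < v \<longrightarrow> f_pf D v < f_pf D u)" if "j < length \<nu>" for j
  proof -
    have "I_block \<nu> j \<subseteq> {1..n}" using that I_block_vertex by blast
    from wrow_filter_sorted_iff[OF True this, of "(>)"] show ?thesis
      by (simp only: lex_less_imp_greater_iff)
  qed
  have K: "sorted_wrt (<) (filter (\<lambda>l. l \<in> K_block n \<mu> i) (wrow D)) \<longleftrightarrow>
      monotone_on (K_block n \<mu> i) (\<le>) (\<le>) (f_pf D)" for i
  proof -
    have "K_block n \<mu> i \<subseteq> {1..n}" using K_block_vertex by blast
    from wrow_filter_sorted_iff[OF True this, of "(<)"] show ?thesis
      unfolding monotone_on_def lex_less_imp_less_iff by blast
  qed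
  have "block_decreasing \<nu> (f_pf D) \<longleftrightarrow>
      (\<forall>j<length \<nu>. \<forall>u\<in>I_block \<nu> j. \<forall>v\<in>I_block \<nu> j. u < v \<longrightarrow> f_pf D v < f_pf D u)"
    unfolding block_decreasing_def same_block_def by blast
  then show ?thesis
    using True unfolding PF_shuffle_def by (auto simp: I K)
qed (simp add: PF_shuffle_def)

lemma sorted_config_iff:
  assumes f: "\<forall>v\<in>{1..n}. int (f v) = start_column c v"
  shows "sorted_config n \<mu> \<nu> c \<longleftrightarrow> block_decreasing \<nu> f \<and>
     (\<forall>i<length \<mu>. monotone_on (K_block n \<mu> i) (\<le>) (\<le>) f)"
proof -
  have "monotone_on (K_block n \<mu> i) (\<le>) (\<ge>) c \<longleftrightarrow> monotone_on (K_block n \<mu> i) (\<le>) (\<le>) f" for i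
  proof -
    have "c u \<ge> c v \<longleftrightarrow> f u \<le> f v" if "u \<in> K_block n \<mu> i" "v \<in> K_block n \<mu> i" for u v
    proof -
      have "below \<nu> u = {}" "below \<nu> v = {}"
        using that K_block_not_I_block by (auto simp: below_def)
      moreover have "int (f u) = start_column c u" "int (f v) = start_column c v"
        using f that K_block_vertex by blast+
      ultimately have "int (f u) \<le> int (f v) \<longleftrightarrow> c v \<le> c u" by (simp add: start_column_def)
      then show ?thesis by simp
    qed
    then show ?thesis by (simp add: monotone_on_def)
  qed
  then show ?thesis unfolding sorted_config_def block_increasing_iff[OF f] by simp
qed

lemma SortRec_iff_PF_shuffle:
  assumes "c \<in> configs n" and rel: "Gamma_rel n k \<mu> \<nu> c D"
  shows "c \<in> SortRec n k \<mu> \<nu> \<longleftrightarrow> D \<in> PF_shuffle n k \<mu> \<nu>"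
proof -
  have D: "D \<in> PF n k" and f: "\<forall>v\<in>{1..n}. int (f_pf D v) = start_column c v"
    using rel by (auto simp: Gamma_rel_iff)
  show ?thesis
    using assms(1) D parking_imp_recurrent[OF D f] sorted_config_iff[OF f]
    by (auto simp: SortRec_def PF_shuffle_iff)
qed

lemma Gamma_rel_unique:
  assumes "Gamma_rel n k \<mu> \<nu> c D" "Gamma_rel n k \<mu> \<nu> c E"
  shows "D = E"
proof (rule PF_eqI)
  show "D \<in> PF n k" "E \<in> PF n k" using assms by (simp_all add: Gamma_rel_def)
  fix v assume "v \<in> {1..n}"
  then have "int (f_pf D v) = int (f_pf E v)" using assms by (simp add: Gamma_rel_iff)
  then show "f_pf D v = f_pf E v" by simp
qed

lemma Gamma_rel_exists:
  assumes c: "c \<in> SortRec n k \<mu> \<nu>"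
  shows "\<exists>D. Gamma_rel n k \<mu> \<nu> c D"
proof -
  define f where "f v = nat (start_column c v)" for v
  have rec: "recurrent n \<epsilon> c" and sorted: "sorted_config n \<mu> \<nu> c" using c by (auto simp: SortRec_def)
  have pos: "1 \<le> start_column c v" if "v \<in> {1..n}" for v
    using stable_start_column that rec by (simp add: recurrent_def)
  have f: "\<forall>v\<in>{1..n}. int (f v) = start_column c v"
    using pos by (fastforce simp: f_def)
  have "block_decreasing \<nu> f" using sorted sorted_config_iff[OF f] by blast
  from recurrent_imp_parking[OF rec f this] have "parking n k f"
    unfolding parking_def using pos by (fastforce simp: f_def)
  then obtain D where "D \<in> PF n k" "\<And>l. l \<in> {1..n} \<Longrightarrow> f_pf D l = f l"
    using PF_exists[OF _ k] by blast
  with f have "Gamma_rel n k \<mu> \<nu> c D" by (simp add: Gamma_rel_iff)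
  then show ?thesis ..
qed

lemma Gamma_rel_ex1: "c \<in> SortRec n k \<mu> \<nu> \<Longrightarrow> \<exists>!D. Gamma_rel n k \<mu> \<nu> c D"
  using Gamma_rel_exists Gamma_rel_unique by blast

lemma Gamma_rel_Gamma: "c \<in> SortRec n k \<mu> \<nu> \<Longrightarrow> Gamma_rel n k \<mu> \<nu> c (Gamma n k \<mu> \<nu> c)"
  unfolding Gamma_def by (rule theI'[OF Gamma_rel_ex1])

text \<open>A configuration of the graph and its columns determine each other, so \<open>\<Gamma>\<close> is injective, and solving
\<open>f v = start_column c v\<close> for \<open>c\<close> yields a preimage.\<close>

lemma Gamma_bij: "bij_betw (Gamma n k \<mu> \<nu>) (SortRec n k \<mu> \<nu>) (PF_shuffle n k \<mu> \<nu>)"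
  unfolding bij_betw_def
proof
  show "inj_on (Gamma n k \<mu> \<nu>) (SortRec n k \<mu> \<nu>)"
  proof (rule inj_onI)
    fix c d assume c: "c \<in> SortRec n k \<mu> \<nu>" and d: "d \<in> SortRec n k \<mu> \<nu>"
      and eq: "Gamma n k \<mu> \<nu> c = Gamma n k \<mu> \<nu> d"
    have "start_column c v = start_column d v" if "v \<in> {1..n}" for v
      using Gamma_rel_Gamma[OF c] Gamma_rel_Gamma[OF d] that unfolding Gamma_rel_iff eq by metis
    then have "c v = d v" if "v \<in> {1..n}" for v using that by (simp add: start_column_def)
    moreover have "c \<in> {1..n} \<rightarrow>\<^sub>E UNIV" "d \<in> {1..n} \<rightarrow>\<^sub>E UNIV"
      using c d by (auto simp: SortRec_def configs_def)
    ultimately show "c = d" by (intro PiE_ext)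
  qed
  show "Gamma n k \<mu> \<nu> ` SortRec n k \<mu> \<nu> = PF_shuffle n k \<mu> \<nu>"
  proof
    show "Gamma n k \<mu> \<nu> ` SortRec n k \<mu> \<nu> \<subseteq> PF_shuffle n k \<mu> \<nu>"
    proof clarify
      fix c assume c: "c \<in> SortRec n k \<mu> \<nu>"
      then have "c \<in> configs n" by (simp add: SortRec_def)
      from SortRec_iff_PF_shuffle[OF this Gamma_rel_Gamma[OF c]]
      show "Gamma n k \<mu> \<nu> c \<in> PF_shuffle n k \<mu> \<nu>" using c by simp
    qed
    show "PF_shuffle n k \<mu> \<nu> \<subseteq> Gamma n k \<mu> \<nu> ` SortRec n k \<mu> \<nu>"
    proof
      fix D assume D: "D \<in> PF_shuffle n k \<mu> \<nu>"
      define c where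
        "c = (\<lambda>v\<in>{1..n}. (int n - 1) * int k - int (f_pf D v) - int (card (below \<nu> v)) + 1)"
      have "c \<in> configs n" by (simp add: c_def configs_def)
      moreover have rel: "Gamma_rel n k \<mu> \<nu> c D"
        using D by (simp add: Gamma_rel_iff PF_shuffle_iff c_def start_column_def)
      ultimately have c: "c \<in> SortRec n k \<mu> \<nu>" using D SortRec_iff_PF_shuffle by blast
      moreover have "Gamma n k \<mu> \<nu> c = D" by (rule Gamma_rel_unique[OF Gamma_rel_Gamma[OF c] rel])
      ultimately show "D \<in> Gamma n k \<mu> \<nu> ` SortRec n k \<mu> \<nu>" by blast
    qed
  qed
qed

text \<open>Relative to \<open>k\<close> edges for each pair of vertices, one edge is missing for each pair in a common
block. The pairs are counted by their larger element.\<close>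

lemma lev_eq:
  "lev n \<epsilon> c = (\<Sum>v=1..n. c v + int (card (below \<nu> v))) - int k * (\<Sum>v=1..n. int v - 1)"
proof -
  have "int (\<Sum>v=1..n. \<Sum>w=v+1..n. \<epsilon> v w) = (\<Sum>v\<in>{1..n}. \<Sum>w | w \<in> {1..n} \<and> v < w. int (\<epsilon> v w))"
    unfolding of_nat_sum by (intro sum.cong) auto
  also have "\<dots> = (\<Sum>w\<in>{1..n}. \<Sum>v | v \<in> {1..n} \<and> v < w. int (\<epsilon> v w))"
    by (rule sum.swap_restrict) auto
  also have "\<dots> = (\<Sum>w\<in>{1..n}. int k * (int w - 1) - int (card (below \<nu> w)))"
  proof (intro sum.cong refl)
    fix w assume w: "w \<in> {1..n}"
    let ?A = "{v. v \<in> {1..n} \<and> v < w}"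
    have "?A = {1..<w}" using w by auto
    then have "int (card ?A) = int w - 1" using w by simp
    moreover have "{u \<in> ?A. same_block \<nu> u w} = below \<nu> w"
      using same_block_vertex(1) by (auto simp: below_def)
    moreover have "(\<Sum>v\<in>?A. int (\<epsilon> v w)) = int k * int (card ?A) - int (card {u \<in> ?A. same_block \<nu> u w})"
      by (rule sum_mult[OF w]) auto
    ultimately show "(\<Sum>v\<in>?A. int (\<epsilon> v w)) = int k * (int w - 1) - int (card (below \<nu> w))"
      by (simp only:)
  qed
  also have "\<dots> = int k * (\<Sum>w=1..n. int w - 1) - (\<Sum>w=1..n. int (card (below \<nu> w)))"
    by (subst sum_subtractf) (simp only: sum_distrib_left)
  finally have edges: "int (\<Sum>v=1..n. \<Sum>w=v+1..n. \<epsilon> v w) = \<dots>" .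
  show ?thesis unfolding lev_def edges sum.distrib by linarith
qed

lemma area_eq:
  assumes D: "D \<in> PF n k"
  shows "area n k D = int k * (\<Sum>i=1..n. int i - 1) - (\<Sum>l=1..n. int (xpos D l))"
proof -
  have len: "norths D = n" using D by (simp add: PF_iff dyck_path_def)
  have "(\<Sum>i=1..n. int (xpos D (wrow D ! (i - 1)))) = (\<Sum>i<n. int (xpos D (wrow D ! i)))"
    by (simp add: sum.atLeast1_atMost_eq)
  also have "\<dots> = sum_list (map (\<lambda>l. int (xpos D l)) (wrow D))"
    by (simp add: sum_list_sum_nth len atLeast0LessThan)
  also have "\<dots> = (\<Sum>l=1..n. int (xpos D l))"
    using D sum_list_distinct_conv_sum_set[of "wrow D"] by (simp add: PF_iff)
  finally have x: "(\<Sum>i=1..n. int (xpos D (wrow D ! (i - 1)))) = (\<Sum>l=1..n. int (xpos D l))" .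
  have "area n k D = (\<Sum>i=1..n. int k * (int i - 1)) - (\<Sum>i=1..n. int (xpos D (wrow D ! (i - 1))))"
    unfolding area_def by (rule sum_subtractf)
  then show ?thesis by (simp only: x sum_distrib_left)
qed

lemma lev_eq_area:
  assumes "Gamma_rel n k \<mu> \<nu> c D"
  shows "lev n \<epsilon> c = area n k D"
proof -
  have D: "D \<in> PF n k" and f: "\<forall>v\<in>{1..n}. int (f_pf D v) = start_column c v"
    using assms by (auto simp: Gamma_rel_iff)
  have "int (xpos D v) = (int n - 1) * int k - (c v + int (card (below \<nu> v)))" if "v \<in> {1..n}" for v
    using bspec[OF f that] by (simp add: f_pf_def start_column_def)
  then have "(\<Sum>v=1..n. int (xpos D v)) =
      (\<Sum>v=1..n. (int n - 1) * int k - (c v + int (card (below \<nu> v))))"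
    by (intro sum.cong) auto
  also have "\<dots> = int n * (int n - 1) * int k - (\<Sum>v=1..n. c v + int (card (below \<nu> v)))"
    by (simp add: sum_subtractf)
  finally have "(\<Sum>v=1..n. int (xpos D v)) = \<dots>" .
  moreover have "2 * (\<Sum>i=1..n. int i - 1) = int n * (int n - 1)"
    by (induction n) (auto simp: algebra_simps)
  then have "int n * (int n - 1) * int k = 2 * (int k * (\<Sum>i=1..n. int i - 1))" by simp
  ultimately show ?thesis unfolding lev_eq area_eq[OF D] by linarith
qed

end

section \<open>Delay and pmaj\<close>

locale delay_run = shuffle_graph +
  fixes c :: config and D :: labelled_path
  assumes D: "D \<in> PF n k"
    and start: "\<forall>v\<in>{1..n}. int (f_pf D v) = start_column c v"
    and decreasing: "block_decreasing \<nu> (f_pf D)"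
begin

abbreviation f :: "nat \<Rightarrow> nat" where "f \<equiv> f_pf D"
abbreviation \<sigma> :: "nat \<Rightarrow> nat" where "\<sigma> \<equiv> sigma n k D"

text \<open>For a state with release counters \<open>r\<close>, the number of releases made so far.\<close>

definition total :: "(nat \<Rightarrow> nat) \<Rightarrow> nat" where
  "total r = (\<Sum>l\<in>{1..n}. r l)"

text \<open>The vertices that can make the next release, whose number is \<open>total r + 1\<close>. For vertices that have
not started, the condition on the column stands in for instability; \<open>unstable_iff\<close> justifies this.\<close>

definition ready :: "(nat \<Rightarrow> nat) \<Rightarrow> nat set" where
  "ready r = {l \<in> {1..n}. r l = 0 \<and> f l \<le> Suc (total r) \<or> 0 < r l \<and> r l < k}"

text \<open>The number of weak ascents of \<open>\<sigma>\<close> that are completed by position \<open>m\<close>; the step from \<open>\<sigma>\<^sub>0\<close> to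
\<open>\<sigma>\<^sub>1\<close> does not count.\<close>

definition ascents :: "nat \<Rightarrow> nat" where
  "ascents m = card {j. 1 \<le> j \<and> \<sigma> j \<le> \<sigma> (j + 1) \<and> j + 1 \<le> m}"

lemma park: "parking n k f"
  by (rule parking_f_pf[OF D])

lemma total_upd:
  assumes i: "i \<in> {1..n}"
  shows "total (r(i := Suc (r i))) = Suc (total r)"
proof -
  have "(\<Sum>l\<in>{1..n} - {i}. (r(i := Suc (r i))) l) = (\<Sum>l\<in>{1..n} - {i}. r l)"
    by (intro sum.cong) auto
  then show ?thesis
    unfolding total_def sum.remove[OF finite_atLeastAtMost i, of r]
      sum.remove[OF finite_atLeastAtMost i, of "r(i := Suc (r i))"] by simp
qed

text \<open>After \<open>total r\<close> steps the multiset of pmaj holds as many copies of each label that has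
entered as the vertex has releases left, and the word \<open>\<sigma>\<close> has so far avoided the vertices
without releases. The second condition says that a vertex releases only after its label has entered.\<close>

definition tracks :: "(nat \<Rightarrow> nat) \<Rightarrow> bool" where
  "tracks r \<longleftrightarrow>
     (\<forall>l. count (fst (pmaj_state n k D (total r))) l =
        (if l \<in> {1..n} \<and> f l \<le> total r then k - r l else 0)) \<and>
     (\<forall>l\<in>{1..n}. r l \<le> k \<and> (0 < r l \<longrightarrow> f l \<le> total r)) \<and>
     (\<forall>l\<in>{1..n}. r l = 0 \<longrightarrow> (\<forall>j\<in>{1..total r}. \<sigma> j \<noteq> l))"

definition bag :: "nat \<Rightarrow> nat multiset" where
  "bag t = fst (pmaj_state n k D t) + (\<Sum>l\<in>{l\<in>{1..n}. f l = Suc t}. replicate_mset k l)"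

lemma sigma_Suc:
  "\<sigma> (Suc t) = (if {l \<in> set_mset (bag t). l < \<sigma> t} \<noteq> {}
     then Max {l \<in> set_mset (bag t). l < \<sigma> t} else Max (set_mset (bag t)))"
proof -
  have "filter_mset P M \<noteq> {#} \<longleftrightarrow> {l \<in> set_mset M. P l} \<noteq> {}" for P and M :: "nat multiset"
    by (metis set_mset_eq_empty_iff set_mset_filter)
  then show ?thesis
    unfolding sigma_def pmaj_state.simps Let_def snd_conv bag_def[symmetric] set_mset_filter
    by (simp only:)
qed

lemma pmaj_state_Suc: "fst (pmaj_state n k D (Suc t)) = bag t - {#\<sigma> (Suc t)#}"
  by (simp add: sigma_def bag_def Let_def)

lemma count_bag:
  assumes "tracks r"
  shows "count (bag (total r)) l = (if l \<in> {1..n} \<and> f l \<le> Suc (total r) then k - r l else 0)"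
proof -
  have "count (\<Sum>l\<in>{l\<in>{1..n}. f l = Suc (total r)}. replicate_mset k l) l =
      (if l \<in> {1..n} \<and> f l = Suc (total r) then k else 0)"
    by (simp add: count_sum sum.delta)
  moreover have "r l = 0" if "l \<in> {1..n}" "f l = Suc (total r)"
    using assms that by (fastforce simp: tracks_def)
  ultimately show ?thesis using assms by (auto simp: bag_def tracks_def)
qed

lemma set_bag:
  assumes "tracks r"
  shows "set_mset (bag (total r)) = ready r"
proof -
  have "f l \<le> Suc (total r)" if "l \<in> {1..n}" "0 < r l" for l
    using assms that by (auto simp: tracks_def intro: le_SucI)
  then show ?thesis
    using k by (auto simp: count_bag[OF assms] ready_def simp flip: count_greater_zero_iff split: if_splits)
qed

lemma tracks_step:
  assumes r: "tracks r" and i: "i \<in> ready r" and \<sigma>: "\<sigma> (Suc (total r)) = i"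
  shows "tracks (r(i := Suc (r i)))"
proof -
  have iv: "i \<in> {1..n}" using i by (simp add: ready_def)
  have fi: "f i \<le> Suc (total r)" and "r i < k"
    using i r k by (auto simp: ready_def tracks_def intro: le_SucI)
  have tot: "total (r(i := Suc (r i))) = Suc (total r)" by (rule total_upd[OF iv])
  have old: "0 < r l \<Longrightarrow> f l \<le> total r" "r l \<le> k" if "l \<in> {1..n}" for l
    using r that by (auto simp: tracks_def)
  have old_\<sigma>: "\<sigma> j \<noteq> l" if "l \<in> {1..n}" "r l = 0" "j \<in> {1..total r}" for l j
    using r that unfolding tracks_def by blast
  show ?thesis
    unfolding tracks_def tot
  proof (intro conjI allI ballI impI)
    fix l
    show "count (fst (pmaj_state n k D (Suc (total r)))) l =
        (if l \<in> {1..n} \<and> f l \<le> Suc (total r) then k - (r(i := Suc (r i))) l else 0)"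
      unfolding pmaj_state_Suc \<sigma> count_diff count_bag[OF r] using iv fi by simp
  next
    fix l assume l: "l \<in> {1..n}"
    show "(r(i := Suc (r i))) l \<le> k" using old(2)[OF l] \<open>r i < k\<close> by simp
    show "f l \<le> Suc (total r)" if "0 < (r(i := Suc (r i))) l"
      using that old(1)[OF l] fi by (cases "l = i") auto
    show "\<sigma> j \<noteq> l" if "(r(i := Suc (r i))) l = 0" "j \<in> {1..Suc (total r)}" for j
    proof -
      have "l \<noteq> i" "r l = 0" using that(1) by (auto split: if_splits)
      then show ?thesis using old_\<sigma>[OF l] \<sigma> that(2) by (cases "j = Suc (total r)") auto
    qed
  qed
qed

lemma total_less:
  assumes "tracks r" "\<exists>i\<in>{1..n}. r i \<noteq> k"
  shows "total r < k * n"
proof -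
  have le: "r l \<le> k" if "l \<in> {1..n}" for l using assms(1) that by (simp add: tracks_def)
  then have "\<exists>i\<in>{1..n}. r i < k" using assms(2) le_neq_implies_less by blast
  then have "total r < (\<Sum>l\<in>{1..n}. k)"
    unfolding total_def using le by (intro sum_strict_mono_ex1) blast+
  then show ?thesis by (simp add: mult.commute)
qed

text \<open>If no vertex were ready, all of the at least \<open>(t + 1) / k\<close> vertices whose column is at most \<open>t + 1\<close>
would have made \<open>k\<close> releases each, more than the \<open>t\<close> releases made so far. This is where the parking
condition ensures that the run does not stop early.\<close>

lemma ready_nonempty:
  assumes r: "tracks r" and "\<exists>i\<in>{1..n}. r i \<noteq> k"
  shows "ready r \<noteq> {}"
proof
  assume empty: "ready r = {}"
  have le: "r l \<le> k" if "l \<in> {1..n}" for l using r that by (simp add: tracks_def)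
  have "Suc (total r) \<le> k * card {l \<in> {1..n}. f l \<le> Suc (total r)}"
    using total_less[OF assms] by (intro parking_le[OF park]) auto
  also have "\<dots> = (\<Sum>l\<in>{l \<in> {1..n}. f l \<le> Suc (total r)}. k)" by simp
  also have "\<dots> = (\<Sum>l\<in>{l \<in> {1..n}. f l \<le> Suc (total r)}. r l)"
  proof (intro sum.cong refl)
    fix l assume "l \<in> {l \<in> {1..n}. f l \<le> Suc (total r)}"
    then show "k = r l" using empty le[of l] by (cases "r l = 0") (auto simp: ready_def)
  qed
  also have "\<dots> \<le> total r" unfolding total_def by (intro sum_mono2) auto
  finally show False by simp
qed

lemma ascents_Suc:
  assumes "1 \<le> t"
  shows "ascents (Suc t) = ascents t + (if \<sigma> t \<le> \<sigma> (Suc t) then 1 else 0)"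
proof -
  have "{j. 1 \<le> j \<and> \<sigma> j \<le> \<sigma> (j + 1) \<and> j + 1 \<le> Suc t} =
      (if \<sigma> t \<le> \<sigma> (Suc t) then insert t else id) {j. 1 \<le> j \<and> \<sigma> j \<le> \<sigma> (j + 1) \<and> j + 1 \<le> t}"
    using assms by (auto simp: le_Suc_eq)
  moreover have "finite {j. 1 \<le> j \<and> \<sigma> j \<le> \<sigma> (j + 1) \<and> j + 1 \<le> t}"
    by (rule finite_subset[of _ "{..t}"]) auto
  ultimately show ?thesis by (simp add: ascents_def)
qed

lemma ascents_0: "ascents 0 = 0" "ascents (Suc 0) = 0"
  by (simp_all add: ascents_def)

text \<open>Position \<open>i\<close> of the sweep against the last letter \<open>\<sigma>\<^sub>t\<close>, when the vertices above \<open>i\<close> have been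
visited in the current sweep. Either the last release happened in the current sweep, and nothing
between \<open>i\<close> and \<open>\<sigma>\<^sub>t\<close> is ready; or it happened in the previous sweep, nothing above \<open>i\<close> is
ready, and neither is anything below \<open>\<sigma>\<^sub>t\<close>, as the previous sweep passed over it. In the second
case the next letter is a weak ascent, which the sweep counter already includes. The initial value
\<open>\<sigma>\<^sub>0 = n + 1\<close> fits the first case. If nothing is ready, the run is over.\<close>

definition in_step :: "nat \<Rightarrow> (nat \<Rightarrow> nat) \<Rightarrow> nat \<Rightarrow> bool" where
  "in_step i r ncyc \<longleftrightarrow> ready r = {} \<or>
     i < \<sigma> (total r) \<and> (\<forall>l\<in>ready r. l < \<sigma> (total r) \<longrightarrow> l \<le> i) \<and> ncyc = ascents (total r) \<or>
     1 \<le> total r \<and> (\<forall>l\<in>ready r. l \<le> i \<and> \<sigma> (total r) \<le> l) \<and> ncyc = Suc (ascents (total r))"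

lemma in_step_next:
  assumes r: "tracks r" and i: "i \<in> ready r" and pos: "in_step i r ncyc"
  shows "\<sigma> (Suc (total r)) = i" "ascents (Suc (total r)) = ncyc"
proof -
  have fin: "finite (ready r)" by (simp add: ready_def)
  have "ready r \<noteq> {}" using i by blast
  then consider
    (down) "i < \<sigma> (total r)" "\<forall>l\<in>ready r. l < \<sigma> (total r) \<longrightarrow> l \<le> i" "ncyc = ascents (total r)" |
    (up) "1 \<le> total r" "\<forall>l\<in>ready r. l \<le> i \<and> \<sigma> (total r) \<le> l" "ncyc = Suc (ascents (total r))"
    using pos by (auto simp: in_step_def)
  then have "\<sigma> (Suc (total r)) = i \<and> ascents (Suc (total r)) = ncyc"
  proof cases
    case down
    then have "Max {l \<in> ready r. l < \<sigma> (total r)} = i" using i fin by (intro Max_eqI) auto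
    then have \<sigma>: "\<sigma> (Suc (total r)) = i"
      unfolding sigma_Suc set_bag[OF r] using i down(1) by auto
    moreover have "ascents (Suc (total r)) = ascents (total r)"
    proof (cases "total r = 0")
      case False
      then show ?thesis using ascents_Suc[of "total r"] \<sigma> down(1) by simp
    qed (simp add: ascents_0)
    ultimately show ?thesis using down(3) by simp
  next
    case up
    have "Max (ready r) = i" using up i fin by (intro Max_eqI) auto
    moreover have "{l \<in> ready r. l < \<sigma> (total r)} = {}" using up(2) by (auto simp: not_less)
    ultimately have "\<sigma> (Suc (total r)) = i" unfolding sigma_Suc set_bag[OF r] by simp
    then show ?thesis using ascents_Suc[OF up(1)] up i by simp
  qed
  then show "\<sigma> (Suc (total r)) = i" "ascents (Suc (total r)) = ncyc" by auto
qed

lemma p_stat_first_release: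
  assumes r: "tracks r" and i: "i \<in> ready r" "r i = 0" and \<sigma>: "\<sigma> (Suc (total r)) = i"
  shows "p_stat n k D i = ascents (Suc (total r))"
proof -
  have iv: "i \<in> {1..n}" using i by (simp add: ready_def)
  have "Suc (total r) = (\<Sum>l\<in>{1..n}. (r(i := Suc (r i))) l)"
    using total_upd[OF iv] by (simp add: total_def)
  also have "\<dots> \<le> (\<Sum>l\<in>{1..n}. k)"
    using tracks_step[OF r i(1) \<sigma>] by (intro sum_mono) (simp add: tracks_def)
  finally have bound: "Suc (total r) \<le> k * n" by (simp add: mult.commute)
  have unseen: "\<sigma> j \<noteq> i" if "j \<in> {1..total r}" for j
    using r iv i(2) that unfolding tracks_def by blast
  have "first_pos n k D i = Suc (total r)"
    unfolding first_pos_def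
  proof (rule Least_equality)
    show "Suc (total r) \<in> {1..k * n} \<and> \<sigma> (Suc (total r)) = i" using bound \<sigma> by simp
    fix m assume m: "m \<in> {1..k * n} \<and> \<sigma> m = i"
    then show "Suc (total r) \<le> m" using unseen[of m] by (cases "m \<le> total r") auto
  qed
  then show ?thesis by (simp add: p_stat_def ascents_def)
qed

text \<open>The number of grains on a vertex that has not started: every release so far sent it one grain, except
for the first release of each element of its block.\<close>

definition reflects :: "config \<Rightarrow> (nat \<Rightarrow> nat) \<Rightarrow> bool" where
  "reflects c' r \<longleftrightarrow> (\<forall>v\<in>{1..n}. r v = 0 \<longrightarrow>
     c' v = c v + 1 + int (total r) - int (card {u \<in> {1..n}. same_block \<nu> u v \<and> 0 < r u}))"

text \<open>The \<open>j\<close>-th release of a vertex has threshold \<open>k - j + 1\<close>. A block element is joined to it by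
\<open>k - 1\<close> edges, so it misses exactly the release with threshold \<open>k\<close>.\<close>

lemma reflects_release:
  assumes c': "reflects c' r" and i: "i \<in> {1..n}" "r i < k"
  shows "reflects (grain_release n \<epsilon> (k - r i) i c') (r(i := Suc (r i)))"
  unfolding reflects_def
proof (intro ballI impI)
  fix v assume v: "v \<in> {1..n}" and "(r(i := Suc (r i))) v = 0"
  then have vi: "v \<noteq> i" and rv: "r v = 0" by (auto split: if_splits)
  let ?S = "{u \<in> {1..n}. same_block \<nu> u v \<and> 0 < r u}"
  let ?S' = "{u \<in> {1..n}. same_block \<nu> u v \<and> 0 < (r(i := Suc (r i))) u}"
  have S': "?S' = (if same_block \<nu> i v then insert i ?S else ?S)"
    using i by auto
  have card_S': "card ?S' = card ?S + (if same_block \<nu> i v \<and> r i = 0 then 1 else 0)"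
    unfolding S' using i(1) by (auto simp: card_insert_if)
  have mult: "int (\<epsilon> i v) = int k - (if same_block \<nu> i v then 1 else 0)"
    by (rule mult_vertices[OF i(1) v]) (use vi in simp)
  then have "k - r i \<le> \<epsilon> i v \<longleftrightarrow> \<not> (same_block \<nu> i v \<and> r i = 0)"
    using i(2) by (auto split: if_splits)
  then have "grain_release n \<epsilon> (k - r i) i c' v =
      c' v + 1 - (if same_block \<nu> i v \<and> r i = 0 then 1 else 0)"
    using v vi by (simp add: grain_release_def)
  moreover have "c' v = c v + 1 + int (total r) - int (card ?S)"
    using c' v rv unfolding reflects_def by blast
  ultimately show "grain_release n \<epsilon> (k - r i) i c' v =
      c v + 1 + int (total (r(i := Suc (r i)))) - int (card ?S')"
    unfolding card_S' total_upd[OF i(1)] by simp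
qed

text \<open>Within a block, the larger elements start to release first.\<close>

definition upward :: "(nat \<Rightarrow> nat) \<Rightarrow> bool" where
  "upward r \<longleftrightarrow> (\<forall>u v. u < v \<and> same_block \<nu> u v \<and> 0 < r u \<longrightarrow> 0 < r v)"

text \<open>When the sweep is about to visit \<open>i\<close>, a larger element of the block of \<open>i\<close> that has not started is
not ready either. This survives the visits because blocks are intervals: between the visits of two
elements of a block only elements of that block are visited, and after one that has not started the
smaller ones do not release.\<close>

definition swept :: "nat \<Rightarrow> (nat \<Rightarrow> nat) \<Rightarrow> bool" where
  "swept i r \<longleftrightarrow> (\<forall>j. i < j \<and> same_block \<nu> i j \<and> r j = 0 \<longrightarrow> Suc (total r) < f j)"

text \<open>By the grain count, \<open>i\<close> is unstable if and only if \<open>f i \<le> t + 1 + w\<close>, where \<open>w\<close> counts the larger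
elements of its block that have not started. If there are such elements, their columns are
distinct and lie strictly between \<open>t + 1\<close> and \<open>f i\<close>, hence \<open>t + 1 + w < f i\<close> and both sides of
the claim are false.\<close>

lemma unstable_iff:
  assumes c': "reflects c' r" and up: "upward r" and sw: "swept i r"
    and i: "i \<in> {1..n}" "r i = 0"
  shows "unstable n \<epsilon> c' i \<longleftrightarrow> f i \<le> Suc (total r)"
proof -
  let ?S = "{u \<in> {1..n}. same_block \<nu> u i \<and> 0 < r u}" and ?W = "{u \<in> above \<nu> i. r u = 0}"
  have "?S = {u \<in> above \<nu> i. 0 < r u}"
  proof (intro equalityI subsetI)
    fix u assume u: "u \<in> ?S"
    then have "u < i \<Longrightarrow> 0 < r i" using up unfolding upward_def by blast
    then have "u \<noteq> i" "\<not> u < i" using u i(2) by auto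
    then show "u \<in> {u \<in> above \<nu> i. 0 < r u}" using u same_block_sym by (auto simp: above_def)
  next
    fix u assume "u \<in> {u \<in> above \<nu> i. 0 < r u}"
    then show "u \<in> ?S" using same_block_sym same_block_vertex(2) by (auto simp: above_def)
  qed
  then have "above \<nu> i = ?S \<union> ?W" "?S \<inter> ?W = {}" by auto
  then have "card (above \<nu> i) = card ?S + card ?W"
    by (metis (no_types, lifting) card_Un_disjoint finite_Un finite_above)
  moreover have "c' i = c i + 1 + int (total r) - int (card ?S)"
    using c' i unfolding reflects_def by blast
  moreover have "int (f i) = start_column c i" using start i by blast
  ultimately have unstable: "unstable n \<epsilon> c' i \<longleftrightarrow> f i \<le> Suc (total r) + card ?W"
    unfolding unstable_def deg_eq[OF i(1)] start_column_def by (auto simp: algebra_simps)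
  show ?thesis
  proof (cases "?W = {}")
    case True
    show ?thesis unfolding unstable True by simp
  next
    case False
    have W: "Suc (total r) < f u \<and> f u < f i" if "u \<in> ?W" for u
      using that sw block_decreasingD[OF decreasing, of i u] by (auto simp: above_def swept_def)
    have "card ?W \<le> f i - Suc (Suc (total r))"
      using W by (intro card_block_le[OF decreasing]) (auto intro: above_same_block simp: Suc_le_eq)
    moreover have "Suc (Suc (total r)) < f i" using False W by force
    ultimately show ?thesis unfolding unstable by linarith
  qed
qed

lemma upward_release:
  assumes up: "upward r" and sw: "swept i r" and i: "i \<in> ready r"
  shows "upward (r(i := Suc (r i)))"
  unfolding upward_def
proof (intro allI impI)
  fix u v assume uv: "u < v \<and> same_block \<nu> u v \<and> 0 < (r(i := Suc (r i))) u"
  show "0 < (r(i := Suc (r i))) v"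
  proof (cases "u = i \<and> r i = 0")
    case True
    then have "f i \<le> Suc (total r)" using i by (simp add: ready_def)
    moreover have "f v < f i" using uv True block_decreasingD[OF decreasing] by blast
    ultimately have "r v \<noteq> 0" using sw uv True by (auto simp: swept_def)
    then show ?thesis by simp
  next
    case False
    then have "0 < r u" using uv by (auto split: if_splits)
    then have "0 < r v" using up uv unfolding upward_def by blast
    then show ?thesis by simp
  qed
qed

lemma unready_swept:
  assumes up: "upward r" and sw: "swept i r" and i: "i \<in> {1..n}"
    and j: "i < j" "same_block \<nu> i j" "r j = 0"
  shows "Suc (total r) < f j" "i \<notin> ready r"
proof -
  show *: "Suc (total r) < f j" using sw j by (simp add: swept_def)
  have "r i = 0" using up j unfolding upward_def by (metis gr0I less_numeral_extra(3))
  moreover have "f j < f i" using block_decreasingD[OF decreasing] j by blast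
  ultimately show "i \<notin> ready r" using * by (simp add: ready_def)
qed

lemma swept_pred:
  assumes up: "upward r" and sw: "swept i r" and i: "i \<in> {1..n}"
  shows "swept (i - 1) (if i \<in> ready r then r(i := Suc (r i)) else r)" (is "swept _ ?r")
  unfolding swept_def
proof (intro allI impI)
  fix j assume j: "i - 1 < j \<and> same_block \<nu> (i - 1) j \<and> ?r j = 0"
  have rj: "r j = 0" using j by (auto split: if_splits)
  have "i \<notin> ready r \<and> Suc (total r) < f j"
  proof (cases "j = i")
    case True
    then show ?thesis using j i by (auto simp: ready_def split: if_splits)
  next
    case False
    then have "i < j" using j i by auto
    moreover have "same_block \<nu> i j"
    proof (rule same_block_trans)
      have "same_block \<nu> (i - 1) i" using same_block_convex[of \<nu> "i - 1" j i] j \<open>i < j\<close> by simp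
      then show "same_block \<nu> i (i - 1)" by (rule same_block_sym)
      show "same_block \<nu> (i - 1) j" using j by blast
    qed
    ultimately show ?thesis using unready_swept[OF up sw i _ _ rj] by blast
  qed
  then show "Suc (total ?r) < f j" by simp
qed

text \<open>The invariant of the run when \<open>i, \<dots>, 1\<close> are the vertices still to be visited in the current sweep.\<close>

definition delay_inv :: "nat \<Rightarrow> delay_state \<Rightarrow> bool" where
  "delay_inv i = (\<lambda>(c', r, d, ncyc). tracks r \<and> reflects c' r \<and> upward r \<and> swept i r \<and>
     in_step i r ncyc \<and> d = (\<Sum>l | l \<in> {1..n} \<and> 0 < r l. p_stat n k D l))"

lemma delay_visit_eq:
  assumes inv: "delay_inv i (c', r, d, ncyc)" and i: "i \<in> {1..n}"
  shows "delay_visit n k \<epsilon> i (c', r, d, ncyc) =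
    (if i \<in> ready r then (grain_release n \<epsilon> (k - r i) i c', r(i := Suc (r i)),
       d + (if r i = 0 then ncyc else 0), ncyc) else (c', r, d, ncyc))"
proof (cases "r i = 0")
  case True
  then have "unstable n \<epsilon> c' i \<longleftrightarrow> i \<in> ready r"
    using inv i unstable_iff[of c' r i] by (auto simp: delay_inv_def ready_def)
  with True show ?thesis by (simp add: delay_visit_def)
next
  case False
  with i show ?thesis by (auto simp: delay_visit_def ready_def)
qed

lemma delay_visit_inv:
  assumes inv: "delay_inv i (c', r, d, ncyc)" and i: "i \<in> {1..n}"
  shows "delay_inv (i - 1) (delay_visit n k \<epsilon> i (c', r, d, ncyc))"
proof (cases "i \<in> ready r")
  case False
  have "in_step (i - 1) r ncyc"
  proof -
    have "l \<le> i - 1" if "l \<in> ready r" "l \<le> i" for l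
      using that False by (cases "l = i") auto
    then show ?thesis using inv by (auto simp: delay_inv_def in_step_def)
  qed
  moreover have "swept (i - 1) r" using swept_pred[of r i] inv i False by (simp add: delay_inv_def)
  ultimately show ?thesis using inv False unfolding delay_visit_eq[OF inv i] by (simp add: delay_inv_def)
next
  case True
  let ?r = "r(i := Suc (r i))"
  have r: "tracks r" "reflects c' r" "upward r" "swept i r" "in_step i r ncyc"
    and d: "d = (\<Sum>l | l \<in> {1..n} \<and> 0 < r l. p_stat n k D l)"
    using inv by (auto simp: delay_inv_def)
  have rk: "r i < k" using True k by (auto simp: ready_def)
  note \<sigma> = in_step_next[OF r(1) True r(5)]
  have "in_step (i - 1) ?r ncyc"
    unfolding in_step_def total_upd[OF i] \<sigma> using i by auto
  moreover have "swept (i - 1) ?r" using swept_pred[OF r(3,4) i] True by simp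
  moreover have "d + (if r i = 0 then ncyc else 0) = (\<Sum>l | l \<in> {1..n} \<and> 0 < ?r l. p_stat n k D l)"
  proof (cases "r i = 0")
    case True
    have "{l. l \<in> {1..n} \<and> 0 < ?r l} = insert i {l. l \<in> {1..n} \<and> 0 < r l}" using i by auto
    then show ?thesis
      using True d p_stat_first_release[OF r(1) \<open>i \<in> ready r\<close> True \<sigma>(1)] \<sigma>(2) by simp
  next
    case False
    then have "{l. l \<in> {1..n} \<and> 0 < ?r l} = {l. l \<in> {1..n} \<and> 0 < r l}" by auto
    then show ?thesis using False d by simp
  qed
  ultimately show ?thesis
    using True tracks_step[OF r(1) True \<sigma>(1)] reflects_release[OF r(2) i rk]
      upward_release[OF r(3,4) True]
    unfolding delay_visit_eq[OF inv i] by (simp add: delay_inv_def)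
qed

text \<open>Relative to the number \<open>t\<close> of releases before the sweep: as long as the sweep has made no release, it
has not passed a ready vertex. So a sweep that starts with a ready vertex makes a release.\<close>

definition progress :: "nat \<Rightarrow> nat \<Rightarrow> delay_state \<Rightarrow> bool" where
  "progress t i = (\<lambda>(c', r, d, ncyc). t < total r \<or> t = total r \<and> (\<forall>l\<in>ready r. l \<le> i))"

lemma delay_visit_progress:
  assumes inv: "delay_inv i (c', r, d, ncyc)" and i: "i \<in> {1..n}"
    and "progress t i (c', r, d, ncyc)"
  shows "progress t (i - 1) (delay_visit n k \<epsilon> i (c', r, d, ncyc))"
proof (cases "i \<in> ready r")
  case True
  then show ?thesis using assms(3) total_upd[OF i]
    unfolding delay_visit_eq[OF inv i] by (auto simp: progress_def)
next
  case False
  then have "l \<le> i - 1" if "l \<in> ready r" "l \<le> i" for l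
    using that by (cases "l = i") auto
  then show ?thesis using False assms(3)
    unfolding delay_visit_eq[OF inv i] by (auto simp: progress_def)
qed

lemma delay_sweep:
  assumes "delay_inv i s" "progress t i s" "i \<le> n"
  shows "delay_inv 0 (fold (delay_visit n k \<epsilon>) (rev [1..<Suc i]) s) \<and>
    progress t 0 (fold (delay_visit n k \<epsilon>) (rev [1..<Suc i]) s)"
  using assms
proof (induction i arbitrary: s)
  case (Suc i)
  obtain c' r d ncyc where s: "s = (c', r, d, ncyc)" by (cases s)
  have "rev [1..<Suc (Suc i)] = Suc i # rev [1..<Suc i]" by simp
  moreover have "delay_inv i (delay_visit n k \<epsilon> (Suc i) s)" "progress t i (delay_visit n k \<epsilon> (Suc i) s)"
    using delay_visit_inv[of "Suc i" c' r d ncyc] delay_visit_progress[of "Suc i" c' r d ncyc t] Suc.prems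
    by (simp_all add: s)
  ultimately show ?case using Suc.IH Suc.prems(3) by simp
qed simp

lemma swept_n: "swept n r"
  using same_block_vertex(2) by (fastforce simp: swept_def)

text \<open>At the end of a sweep nothing remains to be visited. The first case of \<open>in_step\<close> then says that no
ready vertex is smaller than \<open>\<sigma>\<^sub>t\<close>, which is the second case at the beginning of the next sweep, with the
sweep counter increased by one.\<close>

lemma delay_cycle_inv:
  assumes inv: "delay_inv n (c', r, d, ncyc)" and open': "\<exists>i\<in>{1..n}. r i \<noteq> k"
    and cyc: "delay_cycle n k \<epsilon> (c', r, d, ncyc) = (c'', r', d', ncyc')"
  shows "delay_inv n (c'', r', d', ncyc')" "total r < total r'"
proof -
  have "progress (total r) n (c', r, d, ncyc)" by (auto simp: progress_def ready_def)
  from delay_sweep[OF inv this order_refl]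
  obtain m where m: "ncyc' = Suc m" and inv': "delay_inv 0 (c'', r', d', m)"
    and prog: "progress (total r) 0 (c'', r', d', m)"
    using cyc by (auto simp: delay_cycle_def split: prod.splits)
  have pos: "0 < l" if "l \<in> ready r'" for l using that by (simp add: ready_def)
  show *: "total r < total r'"
  proof (rule ccontr)
    assume "\<not> total r < total r'"
    then have eq: "total r = total r'" and "ready r' = {}"
      using prog pos by (fastforce simp: progress_def)+
    moreover have "tracks r'" using inv' by (simp add: delay_inv_def)
    ultimately have "\<forall>i\<in>{1..n}. r' i = k" using ready_nonempty by blast
    then have "total r' = k * n" by (simp add: total_def)
    moreover have "total r < k * n" using total_less open' inv by (simp add: delay_inv_def)
    ultimately show False using eq by simp
  qed
  have "in_step n r' (Suc m)"
  proof -
    consider "ready r' = {}" | "\<forall>l\<in>ready r'. \<sigma> (total r') \<le> l" "m = ascents (total r')"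
      using inv' pos by (fastforce simp: delay_inv_def in_step_def)
    then show ?thesis
    proof cases
      case 2
      moreover have "1 \<le> total r'" using * by simp
      ultimately show ?thesis by (auto simp: in_step_def ready_def)
    qed (simp add: in_step_def)
  qed
  then show "delay_inv n (c'', r', d', ncyc')" using inv' swept_n m by (simp add: delay_inv_def)
qed

lemma delay_inv_initial: "delay_inv n (topple n \<epsilon> 0 c, \<lambda>_. 0, 0, 0)"
proof -
  have tot: "total (\<lambda>_. 0) = 0" by (simp add: total_def)
  have "tracks (\<lambda>_. 0)" unfolding tracks_def tot by (simp add: f_pf_def)
  moreover have "reflects (topple n \<epsilon> 0 c) (\<lambda>_. 0)" by (simp add: reflects_def tot topple_sink)
  moreover have "in_step n (\<lambda>_. 0) 0"
    by (auto simp: in_step_def tot sigma_def ascents_0 ready_def)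
  ultimately show ?thesis using swept_n by (simp add: delay_inv_def upward_def)
qed

lemma del_eq_pmaj: "del n k \<epsilon> c = Some (pmaj n k D)"
proof -
  let ?b = "\<lambda>(c', r, d, ncyc). \<exists>i\<in>{1..n}. r i \<noteq> k" and ?s = "(topple n \<epsilon> 0 c, \<lambda>_. 0, 0, 0) :: delay_state"
  have bound: "total r \<le> k * n" if "tracks r" for r
  proof -
    have "total r \<le> (\<Sum>l\<in>{1..n}. k)"
      unfolding total_def using that by (intro sum_mono) (simp add: tracks_def)
    then show ?thesis by (simp add: mult.commute)
  qed
  have step: "delay_inv n (delay_cycle n k \<epsilon> s) \<and>
      (case delay_cycle n k \<epsilon> s of (c', r, d, ncyc) \<Rightarrow> k * n - total r)
        < (case s of (c', r, d, ncyc) \<Rightarrow> k * n - total r)"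
    if inv: "delay_inv n s" and "?b s" for s
  proof -
    obtain c' r d ncyc where s: "s = (c', r, d, ncyc)" by (cases s)
    obtain c'' r' d' ncyc' where s': "delay_cycle n k \<epsilon> s = (c'', r', d', ncyc')"
      by (cases "delay_cycle n k \<epsilon> s")
    have inv': "delay_inv n (c'', r', d', ncyc')" and less: "total r < total r'"
      using delay_cycle_inv[of c' r d ncyc] inv \<open>?b s\<close> s' by (auto simp: s)
    have "total r' \<le> k * n" using inv' bound by (simp add: delay_inv_def)
    then show ?thesis unfolding s' using inv' less by (simp add: s)
  qed
  obtain t where t: "while_option ?b (delay_cycle n k \<epsilon>) ?s = Some t"
    using measure_while_option_Some[where P = "delay_inv n" and b = ?b, OF step delay_inv_initial] by blast
  have inv: "delay_inv n t"
    using while_option_rule[where P = "delay_inv n", OF _ t delay_inv_initial] step by blast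
  obtain c' r d ncyc where t_eq: "t = (c', r, d, ncyc)" by (cases t)
  have "\<forall>i\<in>{1..n}. r i = k" using while_option_stop[OF t] by (simp add: t_eq)
  then have "{l. l \<in> {1..n} \<and> 0 < r l} = {1..n}" using k by auto
  then have "d = pmaj n k D" using inv by (simp add: t_eq delay_inv_def pmaj_def)
  then show ?thesis unfolding del_def t by (simp add: t_eq)
qed

end

theorem theorem11p5:
  fixes n k :: nat and \<mu> \<nu> :: "nat list"
  assumes "n \<ge> 1" and "k \<ge> 1"
    and "composition \<mu>" and "composition \<nu>"
    and "sum_list \<mu> + sum_list \<nu> = n"
  shows "(\<forall>c\<in>SortRec n k \<mu> \<nu>. \<exists>!D. Gamma_rel n k \<mu> \<nu> c D)
    \<and> bij_betw (Gamma n k \<mu> \<nu>) (SortRec n k \<mu> \<nu>) (PF_shuffle n k \<mu> \<nu>)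
    \<and> (\<forall>c\<in>SortRec n k \<mu> \<nu>.
         lev n (G_mult n k \<nu>) c = area n k (Gamma n k \<mu> \<nu> c)
       \<and> del n k (G_mult n k \<nu>) c = Some (pmaj n k (Gamma n k \<mu> \<nu> c)))"
proof -
  interpret shuffle_graph n k \<mu> \<nu> using assms by unfold_locales
  have "lev n \<epsilon> c = area n k (Gamma n k \<mu> \<nu> c) \<and> del n k \<epsilon> c = Some (pmaj n k (Gamma n k \<mu> \<nu> c))"
    if c: "c \<in> SortRec n k \<mu> \<nu>" for c
  proof -
    have rel: "Gamma_rel n k \<mu> \<nu> c (Gamma n k \<mu> \<nu> c)" by (rule Gamma_rel_Gamma[OF c])
    have "Gamma n k \<mu> \<nu> c \<in> PF_shuffle n k \<mu> \<nu>" using Gamma_bij c by (rule bij_betwE[THEN bspec])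
    then have "block_decreasing \<nu> (f_pf (Gamma n k \<mu> \<nu> c))" by (simp add: PF_shuffle_iff)
    then interpret delay_run n k \<mu> \<nu> c "Gamma n k \<mu> \<nu> c"
      using rel by unfold_locales (auto simp: Gamma_rel_iff)
    show ?thesis using lev_eq_area[OF rel] del_eq_pmaj by blast
  qed
  then show ?thesis using Gamma_rel_ex1 Gamma_bij by blast
qed

end
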